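(* Let $X=(X,d,\mu)$ be a $Q$-regular metric space, $Q\ge1$. Let $0<s<1$, $0<p<Q/s$ and $0<q\le\infty$. There is a constant $C>0$ such that, for all $u\in\dot N^s_{p,q}(X)$, $$\inf_{c\in\mathbb R}\|u-c\|_{L^{p^*(s),q}(X)}\le C\|u\|_{\dot N^s_{p,q}(X)},$$ where $p^*(s)=Qp/(Q-sp)$.
   Context: $\mu$ is a Borel regular outer measure on the metric space $(X,d)$ for which every ball $B(x,r)=\{y\in X:d(y,x)<r\}$ has positive and finite measure, and it is doubling ($\mu(B(x,2r))\le c_D\,\mu(B(x,r))$ for every ball). $X$ is $Q$-regular if there is $c_Q\ge1$ with $c_Q^{-1}r^Q\le\mu(B(x,r))\le c_Qr^Q$ for all $x\in X$ and $0<r\le\operatorname{diam}X$. A sequence $(g_k)_{k\in\mathbb Z}$ of nonnegative measurable functions is a fractional $s$-gradient of a measurable $u\colon X\to[-\infty,\infty]$, written $(g_k)\in\mathbb D^s(u)$, if there is $E\subset X$ with $\mu(E)=0$ such that $|u(x)-u(y)|\le d(x,y)^s(g_k(x)+g_k(y))$ for all $k\in\mathbb Z$ and all $x,y\in X\setminus E$ with $2^{-k-1}\le d(x,y)<2^{-k}$. The homogeneous Haj\l asz--Besov space $\dot N^s_{p,q}(X)$ consists of measurable $u$ with $\|u\|_{\dot N^s_{p,q}(X)}=\inf_{(g_k)\in\mathbb D^s(u)}\big\|(\|g_k\|_{L^p(X)})_{k\in\mathbb Z}\big\|_{l^q}<\infty$. The Lorentz space $L^{p,q}(X)$, $0<p<\infty$,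 $0<q\le\infty$, consists of measurable $u\colon X\to[-\infty,\infty]$ with finite (quasi)norm $\|u\|_{L^{p,q}(X)}=p^{1/q}\big(\int_0^\infty t^q\mu(\{x:|u(x)|\ge t\})^{q/p}\frac{dt}{t}\big)^{1/q}$ if $q<\infty$, and $\|u\|_{L^{p,\infty}(X)}=\sup_{t>0}t\,\mu(\{x:|u(x)|>t\})^{1/p}$ if $q=\infty$.
   Formalization: The space X is assumed to have at least two points; on a one-point space Q-regularity is vacuous and u = +∞ has Besov norm 0 while the Lorentz norm of u − c is infinite for every real c, so the claim fails there. *)

theory Defs
  imports "HOL-Analysis.Analysis"
begin

text \<open>
  The metric space \<open>X\<close> is a type of class \<^class>\<open>metric_space\<close>, and \<open>\<mu>\<close> is an outer measure
  defined on all of its subsets.  Measurability and integrals refer to the measure that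
  Caratheodory's construction attaches to \<open>\<mu>\<close>.
\<close>

definition cara_measure :: "('a set \<Rightarrow> ennreal) \<Rightarrow> 'a measure" where
  "cara_measure \<mu> = measure_of UNIV (lambda_system UNIV UNIV \<mu>) \<mu>"

lemma space_cara_measure [simp]: "space (cara_measure \<mu>) = UNIV"
  by (simp add: cara_measure_def space_measure_of_conv)

lemma
  assumes "outer_measure_space UNIV \<mu>"
  shows sets_cara_measure: "sets (cara_measure \<mu>) = lambda_system UNIV UNIV \<mu>"
    and emeasure_cara_measure:
      "A \<in> lambda_system UNIV UNIV \<mu> \<Longrightarrow> emeasure (cara_measure \<mu>) A = \<mu> A"
proof -
  have "measure_space UNIV (lambda_system UNIV UNIV \<mu>) \<mu>"
    using sigma_algebra.caratheodory_lemma[OF sigma_algebra_Pow, of UNIV \<mu>] assms by simp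
  then have sa: "sigma_algebra UNIV (lambda_system UNIV UNIV \<mu>)"
    and pos: "positive (lambda_system UNIV UNIV \<mu>) \<mu>"
    and ca: "countably_additive (lambda_system UNIV UNIV \<mu>) \<mu>"
    by (auto simp: measure_space_def)
  show "sets (cara_measure \<mu>) = lambda_system UNIV UNIV \<mu>"
    unfolding cara_measure_def by (rule sigma_algebra.sets_measure_of_eq[OF sa])
  show "emeasure (cara_measure \<mu>) A = \<mu> A" if "A \<in> lambda_system UNIV UNIV \<mu>"
    unfolding cara_measure_def by (rule emeasure_measure_of_sigma[OF sa pos ca that])
qed

definition borel_regular_outer_measure :: "('a::topological_space set \<Rightarrow> ennreal) \<Rightarrow> bool" where
  "borel_regular_outer_measure \<mu> \<longleftrightarrow>
     outer_measure_space UNIV \<mu> \<and>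
     sets borel \<subseteq> lambda_system UNIV UNIV \<mu> \<and>
     (\<forall>A. \<exists>B\<in>sets borel. A \<subseteq> B \<and> \<mu> B = \<mu> A)"

definition doubling :: "('a::metric_space set \<Rightarrow> ennreal) \<Rightarrow> bool" where
  "doubling \<mu> \<longleftrightarrow> (\<exists>cD>0. \<forall>x. \<forall>r>0. \<mu> (ball x (2 * r)) \<le> ennreal cD * \<mu> (ball x r))"

definition doubling_metric_measure :: "('a::metric_space set \<Rightarrow> ennreal) \<Rightarrow> bool" where
  "doubling_metric_measure \<mu> \<longleftrightarrow>
     borel_regular_outer_measure \<mu> \<and>
     (\<forall>x. \<forall>r>0. 0 < \<mu> (ball x r) \<and> \<mu> (ball x r) < \<infinity>) \<and>
     doubling \<mu>"

text \<open>
  The library's \<^const>\<open>diameter\<close> is real-valued and hence meaningless for unbounded sets;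
  here the diameter of an unbounded space is \<open>\<infinity>\<close>.
\<close>

definition ediam :: "'a::metric_space itself \<Rightarrow> ennreal" where
  "ediam _ = (SUP x::'a. SUP y::'a. ennreal (dist x y))"

definition Q_regular :: "real \<Rightarrow> ('a::metric_space set \<Rightarrow> ennreal) \<Rightarrow> bool" where
  "Q_regular Q \<mu> \<longleftrightarrow>
     (\<exists>cQ\<ge>1. \<forall>x::'a. \<forall>r>0. ennreal r \<le> ediam TYPE('a) \<longrightarrow>
        ennreal (inverse cQ * r powr Q) \<le> \<mu> (ball x r) \<and>
        \<mu> (ball x r) \<le> ennreal (cQ * r powr Q))"

text \<open>Powers of extended nonnegative numbers, for exponents \<open>a > 0\<close>.\<close>

definition epow :: "ennreal \<Rightarrow> real \<Rightarrow> ennreal" where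
  "epow x a = (if x = \<infinity> then \<infinity> else ennreal (enn2real x powr a))"

definition Lp_norm :: "'a measure \<Rightarrow> real \<Rightarrow> ('a \<Rightarrow> ennreal) \<Rightarrow> ennreal" where
  "Lp_norm M p g = epow (\<integral>\<^sup>+x. epow (g x) p \<partial>M) (1 / p)"

definition lq_norm :: "ennreal \<Rightarrow> (int \<Rightarrow> ennreal) \<Rightarrow> ennreal" where
  "lq_norm q a =
     (if q = \<infinity> then (SUP k. a k)
      else epow (\<Sum>\<^sub>\<infinity>k. epow (a k) (enn2real q)) (1 / enn2real q))"

text \<open>
  In \<^typ>\<open>ereal\<close> one has \<open>\<bar>\<infinity> - \<infinity>\<bar> = \<bar>-\<infinity> - (-\<infinity>)\<bar> = \<infinity>\<close>, the usual convention for
  the gradient inequality at points where \<open>u\<close> is infinite.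
\<close>

definition frac_gradients ::
  "('a::metric_space set \<Rightarrow> ennreal) \<Rightarrow> real \<Rightarrow> ('a \<Rightarrow> ereal) \<Rightarrow> (int \<Rightarrow> 'a \<Rightarrow> ennreal) set" where
  "frac_gradients \<mu> s u =
     {g. (\<forall>k. g k \<in> borel_measurable (cara_measure \<mu>)) \<and>
         (\<exists>E. \<mu> E = 0 \<and>
           (\<forall>k. \<forall>x\<in>-E. \<forall>y\<in>-E. 2 powi (-k - 1) \<le> dist x y \<and> dist x y < 2 powi (-k) \<longrightarrow>
              \<bar>u x - u y\<bar> \<le> enn2ereal (ennreal (dist x y powr s) * (g k x + g k y))))}"

definition hajlasz_besov_norm ::
  "('a::metric_space set \<Rightarrow> ennreal) \<Rightarrow> real \<Rightarrow> real \<Rightarrow> ennreal \<Rightarrow> ('a \<Rightarrow> ereal) \<Rightarrow> ennreal" where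
  "hajlasz_besov_norm \<mu> s p q u =
     (INF g\<in>frac_gradients \<mu> s u. lq_norm q (\<lambda>k. Lp_norm (cara_measure \<mu>) p (g k)))"

definition hajlasz_besov_space ::
  "('a::metric_space set \<Rightarrow> ennreal) \<Rightarrow> real \<Rightarrow> real \<Rightarrow> ennreal \<Rightarrow> ('a \<Rightarrow> ereal) set" where
  "hajlasz_besov_space \<mu> s p q =
     {u \<in> borel_measurable (cara_measure \<mu>). hajlasz_besov_norm \<mu> s p q u < \<infinity>}"

definition lorentz_norm ::
  "('a set \<Rightarrow> ennreal) \<Rightarrow> real \<Rightarrow> ennreal \<Rightarrow> ('a \<Rightarrow> ereal) \<Rightarrow> ennreal" where
  "lorentz_norm \<mu> p q u =
     (if q = \<infinity> then
        (SUP t\<in>{0<..}. ennreal t * epow (\<mu> {x. ereal t < \<bar>u x\<bar>}) (1 / p))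
      else
        ennreal (p powr (1 / enn2real q)) *
        epow (\<integral>\<^sup>+t\<in>{0<..}. ennreal (t powr enn2real q) *
                  epow (\<mu> {x. ereal t \<le> \<bar>u x\<bar>}) (enn2real q / p) * ennreal (1 / t) \<partial>lborel)
             (1 / enn2real q))"

end

theory Submission
  imports Defs
begin

text \<open>
  Write \<open>a\<^sub>k\<close> for the \<open>L\<^sup>p\<close> norm of \<open>g\<^sub>k\<close>, \<open>P = Q p / (Q - s p)\<close> for the Sobolev exponent and
  \<open>\<sigma> = Q / p - s = Q / P > 0\<close>.  The proof is a direct chaining argument.  It shows that the
  decreasing rearrangement of \<open>u - c\<close> at measure comparable to \<open>2 powr (- j Q)\<close> is bounded by a multiple of
  the level \<open>t\<^sub>j = 2 powr (j \<sigma>) \<gamma>\<^sub>j\<close>, where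
  \<open>\<gamma>\<^sub>j = sup\<^sub>i 2 powr (- \<epsilon> \<bar>i - j\<bar>) a\<^sub>i\<close> and \<open>0 < \<epsilon> < min s \<sigma>\<close>.

  This bound suffices.  Since \<open>\<gamma>\<close> changes by a factor of at most \<open>2 powr \<epsilon>\<close> from one index to the
  next and \<open>\<epsilon> < \<sigma>\<close>, the levels \<open>t\<^sub>j\<close> grow geometrically, so cutting the Lorentz integral at the
  \<open>t\<^sub>j\<close> gives a sum comparable to \<open>\<Sum>\<^sub>j (t\<^sub>j 2 powr (- j Q / P)) powr q = \<Sum>\<^sub>j \<gamma>\<^sub>j powr q\<close>
  (\<open>lorentz_norm_le_of_levels\<close>).  A supremum is at most a sum, for every exponent, so
  \<open>\<gamma>\<^sub>j powr q \<le> \<Sum>\<^sub>i 2 powr (- \<epsilon> q \<bar>i - j\<bar>) (a\<^sub>i powr q)\<close>, and summing over \<open>j\<close>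
  first returns \<open>\<Sum>\<^sub>i a\<^sub>i powr q\<close> (\<open>sum_envelope_powr\<close>).  Using a supremum instead of
  a convolution treats \<open>q < 1\<close> and \<open>q \<ge> 1\<close> at once.

  For the bound on the rearrangement, let \<open>G\<^sub>i\<close> be, up to a null set, the set of points where
  \<open>g\<^sub>k \<le> \<kappa> 2 powr (i Q / p + (k - i) (s - \<epsilon>)) a\<^sub>k\<close> for all \<open>k \<ge> i - 2\<close>.  By Chebyshev the
  exceptional sets for the single \<open>k\<close> have measures that form a geometric series, and for \<open>\<kappa>\<close>
  large the complement of \<open>G\<^sub>i\<close> has measure less than that of any ball of radius
  \<open>2 powr (- i - 1)\<close>, as long as \<open>2 powr (- i)\<close> does not exceed the diameter of the space
  (\<open>measure_Compl_good_set\<close>).  At the same time, two points of \<open>G\<^sub>i\<close> at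
  distance less than \<open>2 powr (2 - i)\<close> have values of \<open>u\<close> that differ by at most a multiple
  of \<open>t\<^sub>i\<close>, whatever the actual scale of their distance (\<open>gradient_on_good_sets\<close>).
  Hence from a point of \<open>G\<^sub>j\<close> there is a chain through \<open>G\<^sub>j\<^sub>-\<^sub>1, G\<^sub>j\<^sub>-\<^sub>2, \<dots>\<close> with steps of dyadically
  increasing length.  Two such chains end within
  distance comparable to their scale, and the variation of \<open>u\<close> along them is a geometric sum.
  Thus \<open>\<bar>u x - u y\<bar> \<le> C (t\<^sub>i + t\<^sub>j)\<close> for \<open>x \<in> G\<^sub>i\<close>, \<open>y \<in> G\<^sub>j\<close>, so the intervals of radius
  \<open>C t\<^sub>j\<close> around the values of \<open>u\<close> on \<open>G\<^sub>j\<close> intersect pairwise, and any common point serves as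
  \<open>c\<close> (\<open>common_constant\<close>).  At scales beyond the diameter, the measure of the whole space
  already bounds the distribution function (\<open>measure_space_le_of_small_diameter\<close>).  The argument compares only single values of \<open>u\<close>, which is why it
  works for all \<open>p > 0\<close>, where \<open>u\<close> need not be locally integrable.
\<close>

section \<open>Powers, Chebyshev and the sequence norm\<close>

lemma epow_zero [simp]: "epow 0 e = 0"
  by (simp add: epow_def)

lemma epow_ennreal: "0 \<le> a \<Longrightarrow> epow (ennreal a) e = ennreal (a powr e)"
  by (simp add: epow_def)

lemma epow_mono:
  assumes "x \<le> y" "0 \<le> e"
  shows "epow x e \<le> epow y e"
proof (cases "y = \<infinity>")
  case False
  then have "y < \<infinity>" by (simp add: less_top)
  then show ?thesis
    using assms False unfolding epow_def
    by (auto simp: top_unique intro!: ennreal_leI powr_mono2 enn2real_mono)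
qed (simp add: epow_def)

lemma epow_inverse:
  assumes "0 < e"
  shows "epow (epow x e) (1 / e) = x"
  using assms by (cases x) (auto simp: epow_def powr_powr)

lemma epow_cmult:
  assumes "0 < c" "0 < e"
  shows "epow (ennreal c * x) e = ennreal (c powr e) * epow x e"
  using assms
  by (cases x) (auto simp: epow_def ennreal_mult[symmetric] powr_mult ennreal_mult_top)

lemma measurable_epow [measurable]: "(\<lambda>x. epow x e) \<in> borel_measurable borel"
  unfolding epow_def by measurable

text \<open>
  Chebyshev's inequality, normalised so that the threshold is a multiple of the norm.  In this form
  it also covers \<open>a = 0\<close>, where \<open>g\<close> vanishes almost everywhere.
\<close>

lemma weak_type_inequality:
  assumes g [measurable]: "g \<in> borel_measurable M" and norm: "Lp_norm M p g = ennreal a"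
    and "0 \<le> a" "0 < b" "0 < p"
  shows "emeasure M {x \<in> space M. ennreal (b * a) < g x} \<le> ennreal (b powr (- p))"
proof -
  define I where "I = (\<integral>\<^sup>+x. epow (g x) p \<partial>M)"
  have "epow I (1 / p) = ennreal a"
    using norm by (simp add: Lp_norm_def I_def)
  then have "epow (epow I (1 / p)) (1 / (1 / p)) = ennreal (a powr p)"
    using \<open>0 \<le> a\<close> by (simp add: epow_ennreal)
  then have I: "I = ennreal (a powr p)"
    using epow_inverse[of "1 / p" I] \<open>0 < p\<close> by simp
  show ?thesis
  proof (cases "a = 0")
    case True
    then have "(\<integral>\<^sup>+x. epow (g x) p \<partial>M) = 0"
      using I I_def by simp
    then have "emeasure M {x \<in> space M. epow (g x) p \<noteq> 0} = 0"
      by (subst (asm) nn_integral_0_iff) auto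
    moreover have "{x \<in> space M. ennreal (b * a) < g x} = {x \<in> space M. epow (g x) p \<noteq> 0}"
      using True \<open>0 < p\<close> by (auto simp: epow_def enn2real_eq_0_iff zero_less_iff_neq_zero ennreal_eq_0_iff powr_eq_0_iff not_le)
    ultimately show ?thesis by simp
  next
    case False
    then have ba: "0 < b * a" using \<open>0 \<le> a\<close> \<open>0 < b\<close> by simp
    have "emeasure M {x \<in> space M. ennreal (b * a) < g x}
        \<le> emeasure M {x \<in> space M. 1 \<le> ennreal ((b * a) powr (- p)) * epow (g x) p}"
    proof (rule emeasure_mono)
      show "{x \<in> space M. ennreal (b * a) < g x}
          \<subseteq> {x \<in> space M. 1 \<le> ennreal ((b * a) powr (- p)) * epow (g x) p}"
      proof safe
        fix x assume "ennreal (b * a) < g x"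
        then have "epow (ennreal (b * a)) p \<le> epow (g x) p"
          using \<open>0 < p\<close> by (intro epow_mono) auto
        then have "ennreal ((b * a) powr (- p)) * ennreal ((b * a) powr p)
            \<le> ennreal ((b * a) powr (- p)) * epow (g x) p"
          using ba by (intro mult_left_mono) (auto simp: epow_ennreal)
        moreover have "ennreal ((b * a) powr (- p)) * ennreal ((b * a) powr p) = 1"
          using ba False \<open>0 < b\<close> by (simp add: ennreal_mult[symmetric] powr_add[symmetric])
        ultimately show "1 \<le> ennreal ((b * a) powr (- p)) * epow (g x) p" by simp
      qed
    qed measurable
    also have "\<dots> \<le> ennreal ((b * a) powr (- p)) * (\<integral>\<^sup>+x. epow (g x) p * indicator (space M) x \<partial>M)"
      by (rule nn_integral_Markov_inequality) auto
    also have "(\<integral>\<^sup>+x. epow (g x) p * indicator (space M) x \<partial>M) = I"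
      unfolding I_def by (intro nn_integral_cong) simp
    also have "ennreal ((b * a) powr (- p)) * I = ennreal (b powr (- p))"
      using ba \<open>0 < b\<close> \<open>0 \<le> a\<close> False unfolding I
      by (simp add: ennreal_mult[symmetric] powr_mult powr_minus field_simps)
    finally show ?thesis .
  qed
qed

text \<open>
  Integrals over counting measures admit Tonelli's theorem; this brings the result of such an
  exchange back to the unordered sum that defines the sequence norm.
\<close>

lemma nn_integral_count_space_le_infsum:
  fixes f :: "int \<Rightarrow> ennreal"
  shows "(\<integral>\<^sup>+k. f k \<partial>count_space UNIV) \<le> (\<Sum>\<^sub>\<infinity>k. f k)"
proof -
  have bij: "bij_betw int_decode UNIV UNIV" by (rule bij_int_decode)
  have "(\<integral>\<^sup>+k. f k \<partial>count_space UNIV) = (\<Sum>n. f (int_decode n))"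
    using nn_integral_bij_count_space[OF bij, of f] by (simp add: nn_integral_count_space_nat)
  also have "\<dots> = (SUP n. \<Sum>i<n. f (int_decode i))"
    by (rule suminf_eq_SUP)
  also have "\<dots> \<le> (SUP F\<in>{F. finite F \<and> F \<subseteq> UNIV}. sum f F)"
  proof (rule SUP_mono)
    fix n :: nat
    have "inj_on int_decode {..<n}" using bij by (meson bij_betw_def inj_on_subset top_greatest)
    then show "\<exists>F\<in>{F. finite F \<and> F \<subseteq> UNIV}. (\<Sum>i<n. f (int_decode i)) \<le> sum f F"
      by (intro bexI[of _ "int_decode ` {..<n}"]) (auto simp: sum.reindex)
  qed
  also have "\<dots> = (\<Sum>\<^sub>\<infinity>k. f k)"
    by (rule nonneg_infsum_complete[symmetric]) simp
  finally show ?thesis .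
qed

lemma le_lq_norm:
  assumes "0 < q"
  shows "a k \<le> lq_norm q a"
proof (cases "q = \<infinity>")
  case True
  then show ?thesis by (simp add: lq_norm_def SUP_upper)
next
  case False
  then have q: "0 < enn2real q" using assms by (simp add: enn2real_positive_iff less_top)
  have "epow (a k) (enn2real q) = sum (\<lambda>k. epow (a k) (enn2real q)) {k}" by simp
  also have "\<dots> \<le> (SUP F\<in>{F. finite F \<and> F \<subseteq> UNIV}. sum (\<lambda>k. epow (a k) (enn2real q)) F)"
    by (rule SUP_upper) simp
  also have "\<dots> = (\<Sum>\<^sub>\<infinity>k. epow (a k) (enn2real q))"
    by (rule nonneg_infsum_complete[symmetric]) simp
  finally have "epow (epow (a k) (enn2real q)) (1 / enn2real q) \<le> lq_norm q a"
    using False q unfolding lq_norm_def by (auto intro!: epow_mono)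
  then show ?thesis using epow_inverse[OF q] by simp
qed

lemma powi_eq_powr: "2 powi j = (2 powr real_of_int j :: real)"
  by (simp add: powr_real_of_int' power_int_def)

lemma dyadic_scale_exists:
  assumes "0 < (d::real)"
  obtains k :: int where "2 powi (- k - 1) \<le> d" "d < 2 powi (- k)"
proof
  let ?k = "- \<lfloor>log 2 d\<rfloor> - 1"
  have "2 powr real_of_int \<lfloor>log 2 d\<rfloor> \<le> 2 powr log 2 d"
    by (intro powr_mono) auto
  then show "2 powi (- ?k - 1) \<le> d" using assms unfolding powi_eq_powr by simp
  have "2 powr log 2 d < 2 powr real_of_int (\<lfloor>log 2 d\<rfloor> + 1)"
    by (intro powr_less_mono) linarith+
  then show "d < 2 powi (- ?k)" using assms unfolding powi_eq_powr by (simp add: algebra_simps)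
qed

section \<open>Outer measures\<close>

lemma outer_measure_mono:
  assumes "outer_measure_space UNIV \<mu>" "A \<subseteq> B"
  shows "\<mu> A \<le> \<mu> B"
  using assms by (auto simp: outer_measure_space_def increasing_def)

text \<open>
  Countable subadditivity in the definition of an outer measure concerns disjoint families.
  Disjointing an arbitrary family only shrinks its members.
\<close>

lemma outer_measure_UN:
  fixes A :: "nat \<Rightarrow> 'a set"
  assumes "outer_measure_space UNIV \<mu>"
  shows "\<mu> (\<Union>i. A i) \<le> (\<Sum>i. \<mu> (A i))"
proof -
  have "\<mu> (\<Union>i. A i) = \<mu> (\<Union>i. disjointed A i)"
    by (simp add: UN_disjointed_eq)
  also have "\<dots> \<le> (\<Sum>i. \<mu> (disjointed A i))"
    using assms disjoint_family_disjointed[of A]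
    by (auto simp: outer_measure_space_def countably_subadditive_def)
  also have "\<dots> \<le> (\<Sum>i. \<mu> (A i))"
    by (intro suminf_le summableI outer_measure_mono[OF assms] disjointed_subset)
  finally show ?thesis .
qed

lemma outer_measure_UN_int_null:
  fixes A :: "int \<Rightarrow> 'a set"
  assumes "outer_measure_space UNIV \<mu>" "\<And>i. \<mu> (A i) = 0"
  shows "\<mu> (\<Union>i. A i) = 0"
proof -
  have "(\<Union>i. A i) = (\<Union>n. A (int_decode n))"
    using surj_int_decode by (metis image_image)
  then show ?thesis using outer_measure_UN[OF assms(1), of "\<lambda>n. A (int_decode n)"] assms(2) by simp
qed

lemma outer_measure_Un:
  assumes "outer_measure_space UNIV \<mu>"
  shows "\<mu> (A \<union> B) \<le> \<mu> A + \<mu> B"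
proof -
  have "\<mu> (A \<union> B) = \<mu> (\<Union>i. binaryset A B i)" by (simp add: UN_binaryset_eq)
  also have "\<dots> \<le> (\<Sum>i. \<mu> (binaryset A B i))" by (rule outer_measure_UN[OF assms])
  also have "\<dots> = \<mu> A + \<mu> B"
    using assms by (intro suminf_binaryset_eq) (auto simp: outer_measure_space_def positive_def)
  finally show ?thesis .
qed

lemma null_of_geometric_bound:
  fixes \<mu> :: "'a set \<Rightarrow> ennreal"
  assumes "0 < Q" "\<And>j::int. \<mu> A \<le> ennreal (B * 2 powr (- Q * real_of_int j))"
  shows "\<mu> A = 0"
proof -
  have "2 powr (- Q) < 1" using assms(1) by (simp add: powr_less_one)
  then have "(\<lambda>n. (2 powr (- Q)) ^ n) \<longlonglongrightarrow> 0" by (intro LIMSEQ_realpow_zero) auto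
  then have "(\<lambda>n. ennreal (B * (2 powr (- Q)) ^ n)) \<longlonglongrightarrow> ennreal (B * 0)"
    by (intro tendsto_ennrealI tendsto_mult tendsto_const)
  moreover have "\<mu> A \<le> ennreal (B * (2 powr (- Q)) ^ n)" for n
    using assms(2)[of "int n"] by (simp add: powr_realpow[symmetric] powr_powr)
  ultimately have "\<mu> A \<le> ennreal (B * 0)" by (intro LIMSEQ_le_const) auto
  then show ?thesis by simp
qed

lemma cara_weak_type:
  assumes "outer_measure_space UNIV \<mu>" "g \<in> borel_measurable (cara_measure \<mu>)"
    and "Lp_norm (cara_measure \<mu>) p g = ennreal a" "0 \<le> a" "0 < b" "0 < p"
  shows "\<mu> {x. ennreal (b * a) < g x} \<le> ennreal (b powr (- p))"
proof -
  have "{x. ennreal (b * a) < g x} \<in> sets (cara_measure \<mu>)"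
    using measurable_sets[OF assms(2), of "{ennreal (b * a)<..}"] by (simp add: vimage_def)
  then have "\<mu> {x. ennreal (b * a) < g x} = emeasure (cara_measure \<mu>) {x. ennreal (b * a) < g x}"
    using assms(1) by (simp add: sets_cara_measure emeasure_cara_measure)
  then show ?thesis using weak_type_inequality[OF assms(2-)] by simp
qed

section \<open>The dyadic envelope of a sequence\<close>

text \<open>
  The least sequence above \<open>a\<close> whose values at \<open>i\<close> and \<open>j\<close> differ by a factor of at
  most \<open>2 powr (\<epsilon> * \<bar>i - j\<bar>)\<close>.
\<close>

definition dyadic_envelope :: "real \<Rightarrow> (int \<Rightarrow> real) \<Rightarrow> int \<Rightarrow> real" where
  "dyadic_envelope \<epsilon> a j = (SUP i. 2 powr (- \<epsilon> * \<bar>real_of_int (i - j)\<bar>) * a i)"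

locale bounded_sequence =
  fixes \<epsilon> :: real and a :: "int \<Rightarrow> real" and N :: real
  assumes \<epsilon>_pos: "0 < \<epsilon>"
    and a_nonneg: "\<And>i. 0 \<le> a i"
    and a_bounded: "\<And>i. a i \<le> N"

begin

abbreviation "env \<equiv> dyadic_envelope \<epsilon> a"

lemma term_le: "2 powr (- \<epsilon> * \<bar>real_of_int (i - j)\<bar>) * a i \<le> N"
proof -
  have "2 powr (- \<epsilon> * \<bar>real_of_int (i - j)\<bar>) \<le> 2 powr 0"
    using \<epsilon>_pos by (intro powr_mono) auto
  then have "2 powr (- \<epsilon> * \<bar>real_of_int (i - j)\<bar>) * a i \<le> 1 * N"
    using a_nonneg a_bounded by (intro mult_mono) auto
  then show ?thesis by simp
qed

lemma le_envelope: "2 powr (- \<epsilon> * \<bar>real_of_int (i - j)\<bar>) * a i \<le> env j"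
  unfolding dyadic_envelope_def
  by (rule cSUP_upper[OF UNIV_I bdd_aboveI2]) (rule term_le)

lemma envelope_leI:
  "(\<And>i. 2 powr (- \<epsilon> * \<bar>real_of_int (i - j)\<bar>) * a i \<le> b) \<Longrightarrow> env j \<le> b"
  unfolding dyadic_envelope_def by (rule cSUP_least) auto

lemma envelope_bounded: "env j \<le> N"
  by (rule envelope_leI) (rule term_le)

lemma le_envelope_same: "a j \<le> env j"
  using le_envelope[of j j] by simp

lemma envelope_nonneg: "0 \<le> env j"
  using a_nonneg[of j] le_envelope_same[of j] by simp

text \<open>
  By the triangle inequality for \<open>\<bar>k - i\<bar>\<close>, term by term in the supremum.
\<close>

lemma envelope_slow: "env i \<le> 2 powr (\<epsilon> * \<bar>real_of_int (i - j)\<bar>) * env j"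
proof (rule envelope_leI)
  fix k
  have "2 powr (- \<epsilon> * \<bar>real_of_int (k - i)\<bar>) * a k
     \<le> 2 powr (\<epsilon> * \<bar>real_of_int (i - j)\<bar> + - \<epsilon> * \<bar>real_of_int (k - j)\<bar>) * a k"
  proof (intro mult_right_mono powr_mono a_nonneg)
    have "\<epsilon> * \<bar>real_of_int (k - j)\<bar> \<le> \<epsilon> * (\<bar>real_of_int (k - i)\<bar> + \<bar>real_of_int (i - j)\<bar>)"
      using \<epsilon>_pos by (intro mult_left_mono) auto
    then show "- \<epsilon> * \<bar>real_of_int (k - i)\<bar>
        \<le> \<epsilon> * \<bar>real_of_int (i - j)\<bar> + - \<epsilon> * \<bar>real_of_int (k - j)\<bar>"
      by (simp add: distrib_left)
  qed simp
  also have "\<dots> = 2 powr (\<epsilon> * \<bar>real_of_int (i - j)\<bar>) * (2 powr (- \<epsilon> * \<bar>real_of_int (k - j)\<bar>) * a k)"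
    by (simp only: powr_add mult.assoc)
  also have "\<dots> \<le> 2 powr (\<epsilon> * \<bar>real_of_int (i - j)\<bar>) * env j"
    by (intro mult_left_mono le_envelope) simp
  finally show "2 powr (- \<epsilon> * \<bar>real_of_int (k - i)\<bar>) * a k
     \<le> 2 powr (\<epsilon> * \<bar>real_of_int (i - j)\<bar>) * env j" .
qed

text \<open>
  The \<open>r\<close>-th power of each term of the supremum is one summand on the right, and this holds for
  exponents \<open>r\<close> below and above \<open>1\<close> alike.
\<close>

lemma envelope_powr_le:
  assumes "0 < r"
  shows "ennreal (env j powr r)
    \<le> (\<integral>\<^sup>+i. ennreal (2 powr (- \<epsilon> * r * \<bar>real_of_int (i - j)\<bar>)) * ennreal (a i powr r) \<partial>count_space UNIV)"
    (is "_ \<le> ?S")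
proof (cases "?S = \<infinity>")
  case False
  then obtain S where S: "?S = ennreal S" "0 \<le> S"
    by (cases ?S) auto
  have "env j \<le> S powr (1 / r)"
  proof (rule envelope_leI)
    fix i
    let ?x = "2 powr (- \<epsilon> * \<bar>real_of_int (i - j)\<bar>) * a i"
    have x: "0 \<le> ?x" using a_nonneg by simp
    have "ennreal (?x powr r) = ennreal (2 powr (- \<epsilon> * r * \<bar>real_of_int (i - j)\<bar>)) * ennreal (a i powr r)"
      using a_nonneg by (simp add: powr_mult powr_powr ennreal_mult[symmetric] ac_simps)
    also have "\<dots> \<le> ?S"
      by (rule nn_integral_ge_point) simp
    finally have "?x powr r \<le> S" using S by simp
    then have "(?x powr r) powr (1 / r) \<le> S powr (1 / r)"
      using assms x by (intro powr_mono2) auto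
    then show "?x \<le> S powr (1 / r)"
      using x assms by (simp add: powr_powr)
  qed
  then have "env j powr r \<le> (S powr (1 / r)) powr r"
    using assms envelope_nonneg by (intro powr_mono2) auto
  then show ?thesis using S assms by (simp add: powr_powr)
qed simp

end

lemma two_sided_geometric_series_finite:
  assumes "0 < c"
  shows "\<exists>K>0. \<forall>j. (\<integral>\<^sup>+i. ennreal (2 powr (- c * \<bar>real_of_int (i - j)\<bar>)) \<partial>count_space UNIV) \<le> ennreal K"
proof -
  let ?x = "2 powr (- c)"
  have x: "0 < ?x" "?x < 1" using assms by (auto simp: powr_less_one)
  have pw: "2 powr (- c * real n) = ?x ^ n" for n
    by (simp add: powr_realpow[symmetric] powr_powr)
  have geo: "(\<Sum>n. ennreal (2 powr (- c * real n))) = ennreal (1 / (1 - ?x))"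
    unfolding pw using x by (intro suminf_ennreal_eq) (auto intro!: geometric_sums)
  have main: "(\<integral>\<^sup>+i. ennreal (2 powr (- c * \<bar>real_of_int (i - j)\<bar>)) \<partial>count_space UNIV) \<le> ennreal (2 / (1 - ?x))" for j
  proof -
    have inj: "inj_on (\<lambda>n. j + int n) UNIV" "inj_on (\<lambda>n. j - int n) UNIV"
      by (auto intro: inj_onI)
    have half1: "(\<integral>\<^sup>+i. ennreal (2 powr (- c * \<bar>real_of_int (i - j)\<bar>)) \<partial>count_space (range (\<lambda>n. j + int n))) = ennreal (1 / (1 - ?x))"
      using nn_integral_bij_count_space[OF inj_on_imp_bij_betw[OF inj(1)],
          of "\<lambda>i. ennreal (2 powr (- c * \<bar>real_of_int (i - j)\<bar>))"] geo
      by (simp add: nn_integral_count_space_nat)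
    have half2: "(\<integral>\<^sup>+i. ennreal (2 powr (- c * \<bar>real_of_int (i - j)\<bar>)) \<partial>count_space (range (\<lambda>n. j - int n))) = ennreal (1 / (1 - ?x))"
      using nn_integral_bij_count_space[OF inj_on_imp_bij_betw[OF inj(2)],
          of "\<lambda>i. ennreal (2 powr (- c * \<bar>real_of_int (i - j)\<bar>))"] geo
      by (simp add: nn_integral_count_space_nat)
    have cover: "i \<in> range (\<lambda>n. j + int n) \<or> i \<in> range (\<lambda>n. j - int n)" for i
    proof (cases "j \<le> i")
      case True
      then have "i = j + int (nat (i - j))" by simp
      then show ?thesis by blast
    next
      case False
      then have "i = j - int (nat (j - i))" by simp
      then show ?thesis by blast
    qed
    have "(\<integral>\<^sup>+i. ennreal (2 powr (- c * \<bar>real_of_int (i - j)\<bar>)) \<partial>count_space UNIV)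
       \<le> (\<integral>\<^sup>+i. (ennreal (2 powr (- c * \<bar>real_of_int (i - j)\<bar>)) * indicator (range (\<lambda>n. j + int n)) i
            + ennreal (2 powr (- c * \<bar>real_of_int (i - j)\<bar>)) * indicator (range (\<lambda>n. j - int n)) i) \<partial>count_space UNIV)"
    proof (rule nn_integral_mono)
      fix i
      show "ennreal (2 powr (- c * \<bar>real_of_int (i - j)\<bar>)) \<le>
          ennreal (2 powr (- c * \<bar>real_of_int (i - j)\<bar>)) * indicator (range (\<lambda>n. j + int n)) i
            + ennreal (2 powr (- c * \<bar>real_of_int (i - j)\<bar>)) * indicator (range (\<lambda>n. j - int n)) i"
        using cover[of i] by (elim disjE)
          (simp_all only: indicator_simps mult_1_right add_increasing add_increasing2 zero_le order_refl)
    qed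
    also have "\<dots> = (\<integral>\<^sup>+i. ennreal (2 powr (- c * \<bar>real_of_int (i - j)\<bar>)) \<partial>count_space (range (\<lambda>n. j + int n)))
        + (\<integral>\<^sup>+i. ennreal (2 powr (- c * \<bar>real_of_int (i - j)\<bar>)) \<partial>count_space (range (\<lambda>n. j - int n)))"
      by (subst nn_integral_add) (auto simp: nn_integral_count_space_indicator)
    also have "\<dots> = ennreal (2 / (1 - ?x))"
      unfolding half1 half2 using x by (simp add: ennreal_plus[symmetric] del: ennreal_plus)
    finally show ?thesis .
  qed
  show ?thesis
    using main x by (intro exI[of _ "2 / (1 - ?x)"]) auto
qed

text \<open>
  A discrete Hardy inequality: bound the envelope by the weighted sum of powers, then exchange the
  two sums and use that the weights depend only on \<open>\<bar>i - j\<bar>\<close>.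
\<close>

lemma sum_envelope_powr:
  assumes "0 < \<epsilon>" "0 < r"
  shows "\<exists>K>0. \<forall>a N. bounded_sequence \<epsilon> a N \<longrightarrow>
    (\<integral>\<^sup>+j. ennreal (dyadic_envelope \<epsilon> a j powr r) \<partial>count_space UNIV)
      \<le> ennreal K * (\<integral>\<^sup>+i. ennreal (a i powr r) \<partial>count_space UNIV)"
proof -
  obtain K where K: "K > 0" and
    bound: "\<And>j. (\<integral>\<^sup>+i. ennreal (2 powr (- (\<epsilon> * r) * \<bar>real_of_int (i - j)\<bar>)) \<partial>count_space UNIV) \<le> ennreal K"
    using two_sided_geometric_series_finite[of "\<epsilon> * r"] assms by auto
  have "(\<integral>\<^sup>+j. ennreal (dyadic_envelope \<epsilon> a j powr r) \<partial>count_space UNIV)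
      \<le> ennreal K * (\<integral>\<^sup>+i. ennreal (a i powr r) \<partial>count_space UNIV)"
    if "bounded_sequence \<epsilon> a N" for a N
  proof -
    interpret bounded_sequence \<epsilon> a N by fact
    let ?w = "\<lambda>i j. ennreal (2 powr (- \<epsilon> * r * \<bar>real_of_int (i - j)\<bar>))"
    have "(\<integral>\<^sup>+j. ennreal (env j powr r) \<partial>count_space UNIV)
      \<le> (\<integral>\<^sup>+j. \<integral>\<^sup>+i. ?w i j * ennreal (a i powr r) \<partial>count_space UNIV \<partial>count_space UNIV)"
      by (intro nn_integral_mono envelope_powr_le assms)
    also have "\<dots> = (\<integral>\<^sup>+i. \<integral>\<^sup>+j. ?w i j * ennreal (a i powr r) \<partial>count_space UNIV \<partial>count_space UNIV)"
      by (rule nn_integral_count_space_nn_integral) auto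
    also have "\<dots> \<le> (\<integral>\<^sup>+i. ennreal K * ennreal (a i powr r) \<partial>count_space UNIV)"
    proof (rule nn_integral_mono)
      fix i
      have "(\<integral>\<^sup>+j. ?w i j * ennreal (a i powr r) \<partial>count_space UNIV)
        = (\<integral>\<^sup>+j. ?w j i \<partial>count_space UNIV) * ennreal (a i powr r)"
        by (subst nn_integral_multc) (auto simp: abs_minus_commute)
      also have "\<dots> \<le> ennreal K * ennreal (a i powr r)"
        using bound[of i] by (intro mult_right_mono) (auto simp: ac_simps)
      finally show "(\<integral>\<^sup>+j. ?w i j * ennreal (a i powr r) \<partial>count_space UNIV) \<le> \<dots>" .
    qed
    also have "\<dots> = ennreal K * (\<integral>\<^sup>+i. ennreal (a i powr r) \<partial>count_space UNIV)"
      by (rule nn_integral_cmult) simp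
    finally show ?thesis .
  qed
  with K show ?thesis by blast
qed

section \<open>Dyadic levels and the Lorentz norm\<close>

text \<open>
  The condition \<open>\<epsilon> < \<sigma>\<close> makes the factor \<open>2 powr (\<sigma> * j)\<close> prevail over the variation of the
  envelope, so that the levels below are comparable to a geometric progression.
\<close>

locale dyadic_levels = bounded_sequence +
  fixes \<sigma> D :: real
  assumes \<epsilon>_less: "\<epsilon> < \<sigma>" and D_pos: "0 < D"

begin

definition level :: "int \<Rightarrow> real" where
  "level j = D * (2 powr (\<sigma> * real_of_int j) * env j)"

lemma level_nonneg: "0 \<le> level j"
  using envelope_nonneg D_pos by (simp add: level_def)

lemma level_grow:
  assumes "i \<le> j"
  shows "2 powr ((\<sigma> - \<epsilon>) * real_of_int (j - i)) * level i \<le> level j"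
proof -
  have "2 powr ((\<sigma> - \<epsilon>) * real_of_int (j - i)) * (2 powr (\<sigma> * real_of_int i) * env i)
      \<le> 2 powr ((\<sigma> - \<epsilon>) * real_of_int (j - i)) *
          (2 powr (\<sigma> * real_of_int i) * (2 powr (\<epsilon> * \<bar>real_of_int (i - j)\<bar>) * env j))"
    by (intro mult_left_mono envelope_slow) auto
  also have "\<dots> = 2 powr ((\<sigma> - \<epsilon>) * real_of_int (j - i) + \<sigma> * real_of_int i + \<epsilon> * \<bar>real_of_int (i - j)\<bar>) * env j"
    by (simp only: powr_add mult.assoc)
  also have "(\<sigma> - \<epsilon>) * real_of_int (j - i) + \<sigma> * real_of_int i + \<epsilon> * \<bar>real_of_int (i - j)\<bar>
      = \<sigma> * real_of_int j"
    using assms by (simp add: algebra_simps)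
  finally show ?thesis
    using D_pos by (simp add: level_def mult.left_commute)
qed

lemma level_slow: "level (j + 1) \<le> 2 powr (\<sigma> + \<epsilon>) * level j"
proof -
  have "2 powr (\<sigma> * real_of_int (j + 1)) * env (j + 1)
      \<le> 2 powr (\<sigma> * real_of_int (j + 1)) * (2 powr (\<epsilon> * \<bar>real_of_int (j + 1 - j)\<bar>) * env j)"
    by (intro mult_left_mono envelope_slow) auto
  also have "\<dots> = 2 powr (\<sigma> + \<epsilon>) * (2 powr (\<sigma> * real_of_int j) * env j)"
    by (simp add: powr_add algebra_simps)
  finally show ?thesis
    using D_pos by (simp add: level_def mult.left_commute)
qed

lemma level_mono: "i \<le> j \<Longrightarrow> level i \<le> level j"
proof -
  assume "i \<le> j"
  then have "2 powr 0 \<le> 2 powr ((\<sigma> - \<epsilon>) * real_of_int (j - i))"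
    using \<epsilon>_less by (intro powr_mono) auto
  then have "1 * level i \<le> 2 powr ((\<sigma> - \<epsilon>) * real_of_int (j - i)) * level i"
    using level_nonneg by (intro mult_right_mono) auto
  with level_grow[OF \<open>i \<le> j\<close>] show ?thesis by simp
qed

text \<open>
  If one level vanishes, then so does the envelope there, and slow variation carries this to all
  indices.
\<close>

lemma level_zero_or_pos: "(\<forall>j. level j = 0) \<or> (\<forall>j. 0 < level j)"
proof (rule disjCI)
  assume "\<not> (\<forall>j. 0 < level j)"
  then obtain i where "\<not> 0 < level i" by blast
  then have "env i \<le> 0" using D_pos by (auto simp: level_def zero_less_mult_iff not_less)
  have "env j = 0" for j
  proof -
    have "2 powr (\<epsilon> * \<bar>real_of_int (j - i)\<bar>) * env i \<le> 0"
      using \<open>env i \<le> 0\<close> by (simp add: mult_nonneg_nonpos)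
    then show ?thesis
      using envelope_slow[of j i] envelope_nonneg[of j] by linarith
  qed
  then show "\<forall>j. level j = 0" by (simp add: level_def)
qed

lemma level_locate:
  assumes pos: "\<And>j. 0 < level j" and "0 < t"
  obtains j where "level j < t" "t \<le> level (j + 1)"
proof -
  let ?\<rho> = "2 powr (\<sigma> - \<epsilon>)"
  have \<rho>: "1 < ?\<rho>" using powr_less_mono[of 0 "\<sigma> - \<epsilon>" 2] \<epsilon>_less by simp
  have pw: "2 powr ((\<sigma> - \<epsilon>) * real n) = ?\<rho> ^ n" for n
    by (simp add: powr_realpow[symmetric] powr_powr)
  obtain n where n: "t / level 0 < ?\<rho> ^ n" using real_arch_pow[OF \<rho>] by blast
  obtain m where m: "level 0 / t < ?\<rho> ^ m" using real_arch_pow[OF \<rho>] by blast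
  have "?\<rho> ^ n * level 0 \<le> level (int n)" using level_grow[of 0 "int n"] pw[of n] by simp
  then have hi: "t \<le> level (int n)" using n pos[of 0] by (simp add: field_simps)
  have "?\<rho> ^ m * level (- int m) \<le> level 0" using level_grow[of "- int m" 0] pw[of m] by simp
  moreover have "level 0 < ?\<rho> ^ m * t" using m \<open>0 < t\<close> by (simp add: field_simps)
  ultimately have "?\<rho> ^ m * level (- int m) < ?\<rho> ^ m * t" by linarith
  then have lo: "level (- int m) < t" by simp
  have "\<exists>j. level j < t \<and> t \<le> level (j + 1)"
  proof (rule ccontr)
    assume "\<not> ?thesis"
    then have step: "level j < t \<Longrightarrow> level (j + 1) < t" for j by (meson not_le)
    have "level j < t" if "- int m \<le> j" for j
      using that by (induction j rule: int_ge_induct) (auto intro: lo step)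
    from this[of "int n"] hi show False by simp
  qed
  with that show thesis by blast
qed

end

text \<open>
  If the distribution function of \<open>w\<close> at the \<open>j\<close>-th level is at most \<open>B * 2 powr (- Q * j)\<close>, then
  on the part \<open>level j < t \<le> level (j + 1)\<close> of the half line the quantity
  \<open>t * \<mu> {\<bar>w\<bar> \<ge> t} powr (1 / P)\<close> is at most a multiple of
  \<open>2 powr (\<sigma> * j) * env j * 2 powr (- j * Q / P) = env j\<close>.  This settles \<open>q = \<infinity>\<close>.  For finite
  \<open>q\<close> these parts have uniformly bounded measure with respect to \<open>dt / t\<close>, and summing over
  \<open>j\<close> leads to the sum of powers of the envelope.  When all levels vanish, so does \<open>w\<close> outside a
  null set.
\<close>

lemma lorentz_norm_le_of_levels:
  fixes Q P \<epsilon> \<sigma> D B :: real and q :: ennreal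
  assumes "0 < Q" "0 < P" "\<sigma> = Q / P" "0 < \<epsilon>" "\<epsilon> < \<sigma>" "0 < D" "0 < B" "0 < q"
  shows "\<exists>C>0. \<forall>a N (\<mu> :: 'a set \<Rightarrow> ennreal) w.
    dyadic_levels \<epsilon> a N \<sigma> D \<longrightarrow> outer_measure_space UNIV \<mu> \<longrightarrow>
    (\<forall>j. \<mu> {x. ereal (dyadic_levels.level \<epsilon> a \<sigma> D j) < \<bar>w x\<bar>} \<le> ennreal (B * 2 powr (- Q * real_of_int j))) \<longrightarrow>
    lorentz_norm \<mu> P q w \<le> ennreal C * lq_norm q (\<lambda>k. ennreal (a k))"
proof (cases "q = \<infinity>")
  case True
  define C where "C = 2 powr \<sigma> * D * B powr (1 / P)"
  have "C > 0" using assms by (simp add: C_def)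
  moreover have "lorentz_norm \<mu> P q w \<le> ennreal C * lq_norm q (\<lambda>k. ennreal (a k))"
    if "dyadic_levels \<epsilon> a N \<sigma> D" and om: "outer_measure_space UNIV \<mu>"
      and dist: "\<And>j. \<mu> {x. ereal (dyadic_levels.level \<epsilon> a \<sigma> D j) < \<bar>w x\<bar>} \<le> ennreal (B * 2 powr (- Q * real_of_int j))"
    for a N and \<mu> :: "'a set \<Rightarrow> ennreal" and w
  proof -
    interpret dyadic_levels \<epsilon> a N \<sigma> D by fact
    let ?N = "lq_norm q (\<lambda>k. ennreal (a k))"
    (* The given bound N may exceed the norm, so the envelope is bounded anew by the norm itself. *)
    have env: "ennreal (env j) \<le> ?N" for j
    proof (cases ?N)
      case (real r)
      have "a i \<le> r" for i
        using le_lq_norm[OF \<open>0 < q\<close>, of "\<lambda>k. ennreal (a k)" i] real by simp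
      then interpret b: bounded_sequence \<epsilon> a r using \<epsilon>_pos a_nonneg by unfold_locales auto
      show ?thesis using b.envelope_bounded real by (simp add: ennreal_leI)
    qed simp
    have "ennreal t * epow (\<mu> {x. ereal t < \<bar>w x\<bar>}) (1 / P) \<le> ennreal C * ?N" if "0 < t" for t
      using level_zero_or_pos
    proof
      assume z: "\<forall>j. level j = 0"
      have "\<mu> {x. ereal 0 < \<bar>w x\<bar>} = 0"
        using dist z by (intro null_of_geometric_bound[OF \<open>0 < Q\<close>, of \<mu> _ B]) auto
      moreover have "\<mu> {x. ereal t < \<bar>w x\<bar>} \<le> \<mu> {x. ereal 0 < \<bar>w x\<bar>}"
        using \<open>0 < t\<close> by (intro outer_measure_mono[OF om]) (auto intro: less_trans[rotated])
      ultimately show ?thesis by simp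
    next
      assume "\<forall>j. 0 < level j"
      then obtain j where j: "level j < t" "t \<le> level (j + 1)" using level_locate \<open>0 < t\<close> by blast
      have "\<mu> {x. ereal t < \<bar>w x\<bar>} \<le> \<mu> {x. ereal (level j) < \<bar>w x\<bar>}"
        using j by (intro outer_measure_mono[OF om]) (auto intro: less_trans[rotated])
      also note dist
      finally have "epow (\<mu> {x. ereal t < \<bar>w x\<bar>}) (1 / P) \<le> epow (ennreal (B * 2 powr (- Q * real_of_int j))) (1 / P)"
        using \<open>0 < P\<close> by (intro epow_mono) auto
      also have "\<dots> = ennreal (B powr (1 / P) * 2 powr (- \<sigma> * real_of_int j))"
        using assms by (simp add: epow_ennreal powr_mult powr_powr)
      finally have "ennreal t * epow (\<mu> {x. ereal t < \<bar>w x\<bar>}) (1 / P)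
          \<le> ennreal (level (j + 1)) * ennreal (B powr (1 / P) * 2 powr (- \<sigma> * real_of_int j))"
        using j by (intro mult_mono ennreal_leI) auto
      also have "\<dots> = ennreal (level (j + 1) * (B powr (1 / P) * 2 powr (- \<sigma> * real_of_int j)))"
        using level_nonneg by (simp add: ennreal_mult)
      also have "level (j + 1) * (B powr (1 / P) * 2 powr (- \<sigma> * real_of_int j))
          = D * B powr (1 / P) * (2 powr (\<sigma> * real_of_int (j + 1)) * 2 powr (- \<sigma> * real_of_int j)) * env (j + 1)"
        by (simp add: level_def)
      also have "2 powr (\<sigma> * real_of_int (j + 1)) * 2 powr (- \<sigma> * real_of_int j) = 2 powr \<sigma>"
        by (simp add: powr_add[symmetric] algebra_simps)
      also have "ennreal (D * B powr (1 / P) * 2 powr \<sigma> * env (j + 1)) = ennreal C * ennreal (env (j + 1))"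
        using assms envelope_nonneg by (simp add: C_def ennreal_mult[symmetric] ac_simps)
      also have "\<dots> \<le> ennreal C * ?N" by (intro mult_left_mono env) simp
      finally show ?thesis .
    qed
    then show ?thesis using True unfolding lorentz_norm_def by (auto intro!: SUP_least)
  qed
  ultimately show ?thesis by blast
next
  case False
  define r where "r = enn2real q"
  have r: "0 < r" using False assms unfolding r_def by (simp add: enn2real_positive_iff less_top)
  obtain K where K: "0 < K" "\<And>a N. bounded_sequence \<epsilon> a N \<Longrightarrow>
      (\<integral>\<^sup>+j. ennreal (dyadic_envelope \<epsilon> a j powr r) \<partial>count_space UNIV)
        \<le> ennreal K * (\<integral>\<^sup>+i. ennreal (a i powr r) \<partial>count_space UNIV)"
    using sum_envelope_powr[OF \<open>0 < \<epsilon>\<close> r] by blast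
  define L where "L = 2 powr (\<sigma> + \<epsilon>) * (2 powr (\<sigma> + \<epsilon>) * D) powr r * B powr (r / P)"
  have L: "0 < L" using assms by (simp add: L_def)
  define C where "C = P powr (1 / r) * (L * K) powr (1 / r)"
  have "C > 0" using assms L K by (simp add: C_def)
  moreover have "lorentz_norm \<mu> P q w \<le> ennreal C * lq_norm q (\<lambda>k. ennreal (a k))"
    if "dyadic_levels \<epsilon> a N \<sigma> D" and om: "outer_measure_space UNIV \<mu>"
      and dist: "\<And>j. \<mu> {x. ereal (dyadic_levels.level \<epsilon> a \<sigma> D j) < \<bar>w x\<bar>} \<le> ennreal (B * 2 powr (- Q * real_of_int j))"
    for a N and \<mu> :: "'a set \<Rightarrow> ennreal" and w
  proof -
    interpret dyadic_levels \<epsilon> a N \<sigma> D by fact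
    let ?F = "\<lambda>t. ennreal (t powr r) * epow (\<mu> {x. ereal t \<le> \<bar>w x\<bar>}) (r / P) * ennreal (1 / t)"
    let ?S = "\<integral>\<^sup>+i. ennreal (a i powr r) \<partial>count_space UNIV"
    have "(\<integral>\<^sup>+t\<in>{0<..}. ?F t \<partial>lborel) \<le> ennreal (L * K) * ?S"
      using level_zero_or_pos
    proof
      assume z: "\<forall>j. level j = 0"
      have z0: "\<mu> {x. ereal 0 < \<bar>w x\<bar>} = 0"
        using dist z by (intro null_of_geometric_bound[OF \<open>0 < Q\<close>, of \<mu> _ B]) auto
      have *: "?F t * indicator {0<..} t = 0" for t
      proof (cases "0 < t")
        case True
        then have "\<mu> {x. ereal t \<le> \<bar>w x\<bar>} \<le> \<mu> {x. ereal 0 < \<bar>w x\<bar>}"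
          by (intro outer_measure_mono[OF om]) (auto intro: less_le_trans[rotated])
        then show ?thesis using z0 by simp
      qed simp
      show ?thesis unfolding * by simp
    next
      assume pos: "\<forall>j. 0 < level j"
      (* The bound for the integrand on the j-th part, with 1 / t replaced by its value at the left end. *)
      define M where "M j = level (j + 1) powr r * (B * 2 powr (- Q * real_of_int j)) powr (r / P) / level j" for j
      have M: "0 \<le> M j" for j unfolding M_def using level_nonneg by simp
      have pw: "?F t * indicator {0<..} t
          \<le> (\<integral>\<^sup>+j. ennreal (M j) * indicator {level j<..level (j + 1)} t \<partial>count_space UNIV)" for t
      proof (cases "0 < t")
        case True
        then obtain j where j: "level j < t" "t \<le> level (j + 1)" using level_locate pos by blast
        have "\<mu> {x. ereal t \<le> \<bar>w x\<bar>} \<le> \<mu> {x. ereal (level j) < \<bar>w x\<bar>}"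
          using j by (intro outer_measure_mono[OF om]) (auto intro: less_le_trans[rotated])
        also note dist
        finally have "epow (\<mu> {x. ereal t \<le> \<bar>w x\<bar>}) (r / P) \<le> epow (ennreal (B * 2 powr (- Q * real_of_int j))) (r / P)"
          using \<open>0 < P\<close> r by (intro epow_mono) auto
        also have "\<dots> = ennreal ((B * 2 powr (- Q * real_of_int j)) powr (r / P))"
          using assms by (simp add: epow_ennreal)
        finally have "?F t \<le> ennreal (level (j + 1) powr r) * ennreal ((B * 2 powr (- Q * real_of_int j)) powr (r / P)) * ennreal (1 / level j)"
          using j True r pos by (intro mult_mono ennreal_leI powr_mono2 divide_left_mono) auto
        also have "\<dots> = ennreal (M j) * indicator {level j<..level (j + 1)} t"
          using j level_nonneg by (simp add: M_def ennreal_mult[symmetric])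
        also have "\<dots> \<le> (\<integral>\<^sup>+j. ennreal (M j) * indicator {level j<..level (j + 1)} t \<partial>count_space UNIV)"
          by (rule nn_integral_ge_point) simp
        finally show ?thesis using True by simp
      qed simp
      have "(\<integral>\<^sup>+t\<in>{0<..}. ?F t \<partial>lborel)
        \<le> (\<integral>\<^sup>+t. \<integral>\<^sup>+j. ennreal (M j) * indicator {level j<..level (j + 1)} t \<partial>count_space UNIV \<partial>lborel)"
        by (intro nn_integral_mono pw)
      also have "\<dots> = (\<integral>\<^sup>+j. \<integral>\<^sup>+t. ennreal (M j) * indicator {level j<..level (j + 1)} t \<partial>lborel \<partial>count_space UNIV)"
        by (rule nn_integral_count_space_nn_integral) auto
      also have "\<dots> \<le> (\<integral>\<^sup>+j. ennreal L * ennreal (env j powr r) \<partial>count_space UNIV)"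
      proof (rule nn_integral_mono)
        fix j
        have "(\<integral>\<^sup>+t. ennreal (M j) * indicator {level j<..level (j + 1)} t \<partial>lborel)
            = ennreal (M j) * ennreal (level (j + 1) - level j)"
          using level_mono[of j "j + 1"] by (simp add: nn_integral_cmult_indicator)
        also have "\<dots> = ennreal (M j * (level (j + 1) - level j))"
          using M level_mono[of j "j + 1"] by (simp add: ennreal_mult)
        also have "\<dots> \<le> ennreal (L * env j powr r)"
        proof (rule ennreal_leI)
          have "level (j + 1) - level j \<le> 2 powr (\<sigma> + \<epsilon>) * level j"
            using level_slow[of j] level_nonneg[of j] by linarith
          then have "M j * (level (j + 1) - level j) \<le> M j * (2 powr (\<sigma> + \<epsilon>) * level j)"
            by (intro mult_left_mono M)
          also have "\<dots> = 2 powr (\<sigma> + \<epsilon>) * (level (j + 1) powr r * (B * 2 powr (- Q * real_of_int j)) powr (r / P))"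
            using pos[rule_format, of j] by (simp add: M_def)
          also have "\<dots> \<le> 2 powr (\<sigma> + \<epsilon>) * ((2 powr (\<sigma> + \<epsilon>) * level j) powr r * (B * 2 powr (- Q * real_of_int j)) powr (r / P))"
            using r level_nonneg by (intro mult_left_mono mult_right_mono powr_mono2 level_slow) auto
          also have "(B * 2 powr (- Q * real_of_int j)) powr (r / P) = B powr (r / P) * 2 powr (- \<sigma> * real_of_int j * r)"
            using assms by (simp add: powr_mult powr_powr)
          also have "(2 powr (\<sigma> + \<epsilon>) * level j) powr r
              = (2 powr (\<sigma> + \<epsilon>) * D) powr r * 2 powr (\<sigma> * real_of_int j * r) * env j powr r"
            using envelope_nonneg D_pos by (simp add: level_def powr_mult powr_powr)
          also have "2 powr (\<sigma> + \<epsilon>) * ((2 powr (\<sigma> + \<epsilon>) * D) powr r * 2 powr (\<sigma> * real_of_int j * r) * env j powr r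
              * (B powr (r / P) * 2 powr (- \<sigma> * real_of_int j * r)))
              = L * env j powr r * (2 powr (\<sigma> * real_of_int j * r) * 2 powr (- \<sigma> * real_of_int j * r))"
            by (simp add: L_def)
          also have "2 powr (\<sigma> * real_of_int j * r) * 2 powr (- \<sigma> * real_of_int j * r) = 1"
            by (simp add: powr_add[symmetric])
          finally show "M j * (level (j + 1) - level j) \<le> L * env j powr r" by simp
        qed
        also have "\<dots> = ennreal L * ennreal (env j powr r)" using L by (simp add: ennreal_mult)
        finally show "(\<integral>\<^sup>+t. ennreal (M j) * indicator {level j<..level (j + 1)} t \<partial>lborel) \<le> \<dots>" .
      qed
      also have "\<dots> = ennreal L * (\<integral>\<^sup>+j. ennreal (env j powr r) \<partial>count_space UNIV)"
        by (rule nn_integral_cmult) simp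
      also have "\<dots> \<le> ennreal L * (ennreal K * ?S)"
        by (intro mult_left_mono K(2)) (auto intro: bounded_sequence_axioms)
      also have "\<dots> = ennreal (L * K) * ?S"
        using L K by (simp add: ennreal_mult mult.assoc)
      finally show ?thesis .
    qed
    also have "?S \<le> (\<Sum>\<^sub>\<infinity>k. epow (ennreal (a k)) r)"
      using nn_integral_count_space_le_infsum a_nonneg by (simp add: epow_ennreal)
    finally have "(\<integral>\<^sup>+t\<in>{0<..}. ?F t \<partial>lborel) \<le> ennreal (L * K) * (\<Sum>\<^sub>\<infinity>k. epow (ennreal (a k)) r)"
      by (simp add: mult_left_mono)
    then have "epow (\<integral>\<^sup>+t\<in>{0<..}. ?F t \<partial>lborel) (1 / r)
       \<le> epow (ennreal (L * K) * (\<Sum>\<^sub>\<infinity>k. epow (ennreal (a k)) r)) (1 / r)"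
      using r by (intro epow_mono) auto
    also have "\<dots> = ennreal ((L * K) powr (1 / r)) * lq_norm q (\<lambda>k. ennreal (a k))"
      using r L K False by (subst epow_cmult) (auto simp: lq_norm_def r_def)
    finally have "ennreal (P powr (1 / r)) * epow (\<integral>\<^sup>+t\<in>{0<..}. ?F t \<partial>lborel) (1 / r)
       \<le> ennreal (P powr (1 / r)) * (ennreal ((L * K) powr (1 / r)) * lq_norm q (\<lambda>k. ennreal (a k)))"
      by (rule mult_left_mono) simp
    then show ?thesis
      using False by (simp add: lorentz_norm_def r_def[symmetric] C_def ennreal_mult mult.assoc)
  qed
  ultimately show ?thesis by blast
qed

section \<open>Chaining through good sets\<close>

text \<open>
  Here \<open>J\<close> stands for the scales \<open>2 powi (- j)\<close> that do not exceed the diameter.  A chain from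
  \<open>G i\<close> down to \<open>G m\<close> stays within \<open>2 powi (- m)\<close> of its starting point because its steps halve,
  and the hypothesis \<open>grow\<close> turns the variation along it into a telescoping sum.  To compare points
  \<open>x\<close> and \<open>y\<close>, both chains run down to a scale \<open>m\<close> that is comparable to their distance or larger,
  where \<open>near\<close> applies.  The scale \<open>m\<close> exists in \<open>J\<close> because some distance, namely
  that of \<open>x\<close> and \<open>y\<close>, is that large.  Finally a family of compact intervals that intersect
  pairwise has a common point, namely the supremum of the left ends.
\<close>

lemma common_constant:
  fixes v :: "'a::metric_space \<Rightarrow> real" and G :: "int \<Rightarrow> 'a set" and t :: "int \<Rightarrow> real"
  assumes t_nonneg: "\<And>i. 0 \<le> t i"
    and grow: "\<And>i. A * t (i + 1) \<le> C * (t (i + 1) - t i)"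
    and "0 \<le> A" "A \<le> C"
    and J_up: "\<And>i j. i \<in> J \<Longrightarrow> i \<le> j \<Longrightarrow> j \<in> J"
    and J_scale: "\<And>x y :: 'a. \<And>k. 2 powi (- k) \<le> dist x y \<Longrightarrow> k \<in> J"
    and step: "\<And>i x. i \<in> J \<Longrightarrow> x \<in> G (i + 1) \<Longrightarrow>
      \<exists>y\<in>G i. dist x y \<le> 2 powi (- (i + 1)) \<and> \<bar>v x - v y\<bar> \<le> A * t (i + 1)"
    and near: "\<And>i x y. i \<in> J \<Longrightarrow> x \<in> G i \<Longrightarrow> y \<in> G i \<Longrightarrow> dist x y < 2 powi (2 - i) \<Longrightarrow>
      \<bar>v x - v y\<bar> \<le> A * t i"
  shows "\<exists>c. \<forall>j\<in>J. \<forall>x\<in>G j. \<bar>v x - c\<bar> \<le> C * t j"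
proof -
  have chain: "\<exists>y\<in>G m. dist x y \<le> 2 powi (- m) - 2 powi (- (m + int n)) \<and> \<bar>v x - v y\<bar> \<le> C * (t (m + int n) - t m)"
    if "m \<in> J" "x \<in> G (m + int n)" for m n x
    using that
  proof (induction n arbitrary: x)
    case 0
    then show ?case by (intro bexI[of _ x]) auto
  next
    case (Suc n)
    let ?i = "m + int n"
    have "?i \<in> J" using Suc.prems J_up by simp
    moreover have "x \<in> G (?i + 1)" using Suc.prems by (simp add: ac_simps)
    ultimately obtain y where y: "y \<in> G ?i" "dist x y \<le> 2 powi (- (?i + 1))" "\<bar>v x - v y\<bar> \<le> A * t (?i + 1)"
      using step by blast
    obtain z where z: "z \<in> G m" "dist y z \<le> 2 powi (- m) - 2 powi (- ?i)" "\<bar>v y - v z\<bar> \<le> C * (t ?i - t m)"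
      using Suc.IH[OF Suc.prems(1) y(1)] by blast
    have half: "(2::real) powi (- ?i) = 2 * 2 powi (- (?i + 1))"
      using power_int_add[of "2::real" 1 "- (?i + 1)"] by simp
    have "dist x z \<le> 2 powi (- m) - 2 powi (- (?i + 1))"
      using dist_triangle[of x z y] y(2) z(2) half by linarith
    moreover have "\<bar>v x - v z\<bar> \<le> C * (t (?i + 1) - t m)"
    proof -
      have "\<bar>v x - v z\<bar> \<le> A * t (?i + 1) + C * (t ?i - t m)" using y(3) z(3) by linarith
      also have "\<dots> \<le> C * (t (?i + 1) - t ?i) + C * (t ?i - t m)" using grow[of ?i] by simp
      finally show ?thesis by (simp add: algebra_simps)
    qed
    ultimately show ?case using z(1) by (auto intro!: bexI[of _ z] simp: ac_simps)
  qed
  have pair: "\<bar>v x - v y\<bar> \<le> C * t i + C * t j"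
    if ij: "i \<in> J" "j \<in> J" and xy: "x \<in> G i" "y \<in> G j" for i j x y
  proof (cases "x = y")
    case True
    then show ?thesis using t_nonneg[of i] t_nonneg[of j] \<open>0 \<le> A\<close> \<open>A \<le> C\<close> by simp
  next
    case False
    then obtain k where k: "2 powi (- k - 1) \<le> dist x y" "dist x y < 2 powi (- k)"
      using dyadic_scale_exists[of "dist x y"] by auto
    have "- (k + 1) = - k - 1" by simp
    with k(1) have "2 powi (- (k + 1)) \<le> dist x y" by (simp only:)
    then have "k + 1 \<in> J" by (rule J_scale)
    (* A scale coarse enough for both chains to reach it and to exceed dist x y / 2. *)
    define m where "m = Min {i, j, k + 1}"
    have m: "m \<in> J" "m \<le> i" "m \<le> j" "m \<le> k + 1"
      using ij \<open>k + 1 \<in> J\<close> unfolding m_def by (auto simp: min_def)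
    obtain x' where x': "x' \<in> G m" "dist x x' \<le> 2 powi (- m) - 2 powi (- i)" "\<bar>v x - v x'\<bar> \<le> C * (t i - t m)"
      using chain[of m x "nat (i - m)"] m xy by auto
    obtain y' where y': "y' \<in> G m" "dist y y' \<le> 2 powi (- m) - 2 powi (- j)" "\<bar>v y - v y'\<bar> \<le> C * (t j - t m)"
      using chain[of m y "nat (j - m)"] m xy by auto
    have "(2::real) powi (- k) \<le> 2 powi (1 - m)"
      using m by (intro power_int_increasing) auto
    moreover have "(2::real) powi (1 - m) = 2 * 2 powi (- m)"
      using power_int_add[of "2::real" 1 "- m"] by simp
    moreover have "(2::real) powi (2 - m) = 4 * 2 powi (- m)"
      using power_int_add[of "2::real" 2 "- m"] by simp
    moreover have "(0::real) < 2 powi (- i)" "(0::real) < 2 powi (- j)" by simp_all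
    moreover have "dist x' y' \<le> dist x x' + dist x y + dist y y'"
      using dist_triangle[of x' y' x] dist_triangle[of x y' y] by (simp add: dist_commute)
    ultimately have "dist x' y' < 2 powi (2 - m)"
      using x'(2) y'(2) k(2) by linarith
    then have "\<bar>v x' - v y'\<bar> \<le> A * t m" using near m(1) x'(1) y'(1) by blast
    also have "\<dots> \<le> C * t m" using \<open>A \<le> C\<close> t_nonneg by (intro mult_right_mono)
    finally have "\<bar>v x - v y\<bar> \<le> C * (t i - t m) + C * t m + C * (t j - t m)"
      using x'(3) y'(3) by linarith
    moreover have "0 \<le> C * t m" using t_nonneg[of m] \<open>0 \<le> A\<close> \<open>A \<le> C\<close> by simp
    ultimately show ?thesis by (simp add: right_diff_distrib)
  qed
  (* The left ends of the intervals of radius C * t i around the values v x. *)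
  define L where "L = {v x - C * t i |x i. i \<in> J \<and> x \<in> G i}"
  have "\<bar>v x - Sup L\<bar> \<le> C * t j" if "j \<in> J" "x \<in> G j" for j x
  proof -
    have up: "l \<le> v x + C * t j" if "l \<in> L" for l
    proof -
      obtain y i where "l = v y - C * t i" "i \<in> J" "y \<in> G i" using \<open>l \<in> L\<close> by (auto simp: L_def)
      then show ?thesis using pair[of i j y x] \<open>j \<in> J\<close> \<open>x \<in> G j\<close> by linarith
    qed
    have mem: "v x - C * t j \<in> L" using that by (auto simp: L_def)
    then have "v x - C * t j \<le> Sup L" using up by (intro cSup_upper bdd_aboveI)
    moreover have "Sup L \<le> v x + C * t j" using mem up by (intro cSup_least) auto
    ultimately show ?thesis by linarith
  qed
  then show ?thesis by blast
qed

text \<open>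
  The functions \<open>g k\<close> are finite almost everywhere, having finite norms.  Where they are
  finite, the gradient inequality excludes infinite values of \<open>u\<close>, since
  \<open>\<bar>\<infinity> - \<infinity>\<bar> = \<infinity>\<close>; it only needs a second point outside the null set to compare with, and two
  disjoint balls provide one.
\<close>

lemma finite_off_null_set:
  fixes \<mu> :: "'a::metric_space set \<Rightarrow> ennreal" and u :: "'a \<Rightarrow> ereal"
  assumes om: "outer_measure_space UNIV \<mu>"
    and balls: "\<And>x r. 0 < r \<Longrightarrow> 0 < \<mu> (ball x r)"
    and points: "\<exists>x y :: 'a. x \<noteq> y"
    and g: "g \<in> frac_gradients \<mu> s u"
    and norm: "\<And>k. Lp_norm (cara_measure \<mu>) p (g k) = ennreal (a k)" "\<And>k. 0 \<le> a k" and "0 < p"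
  obtains Z where "\<mu> Z = 0" "\<And>x. x \<notin> Z \<Longrightarrow> \<bar>u x\<bar> \<noteq> \<infinity>"
    and "\<And>k x y. x \<notin> Z \<Longrightarrow> y \<notin> Z \<Longrightarrow> 2 powi (- k - 1) \<le> dist x y \<Longrightarrow> dist x y < 2 powi (- k) \<Longrightarrow>
      ennreal \<bar>real_of_ereal (u x) - real_of_ereal (u y)\<bar> \<le> ennreal (dist x y powr s) * (g k x + g k y)"
proof -
  from g obtain E where E: "\<mu> E = 0" and grad: "\<And>k x y. x \<notin> E \<Longrightarrow> y \<notin> E \<Longrightarrow>
      2 powi (- k - 1) \<le> dist x y \<Longrightarrow> dist x y < 2 powi (- k) \<Longrightarrow>
      \<bar>u x - u y\<bar> \<le> enn2ereal (ennreal (dist x y powr s) * (g k x + g k y))"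
    and meas: "\<And>k. g k \<in> borel_measurable (cara_measure \<mu>)"
    unfolding frac_gradients_def by blast
  have inf: "\<mu> {x. g k x = \<infinity>} = 0" for k
  proof (rule null_of_geometric_bound[OF \<open>0 < p\<close>, of \<mu> _ 1])
    fix j :: int
    have "\<mu> {x. g k x = \<infinity>} \<le> \<mu> {x. ennreal (2 powr real_of_int j * a k) < g k x}"
      by (intro outer_measure_mono[OF om]) auto
    also have "\<dots> \<le> ennreal ((2 powr real_of_int j) powr (- p))"
      using norm \<open>0 < p\<close> by (intro cara_weak_type[OF om meas]) auto
    finally show "\<mu> {x. g k x = \<infinity>} \<le> ennreal (1 * 2 powr (- p * real_of_int j))"
      by (simp add: powr_powr mult.commute)
  qed
  define Z where "Z = E \<union> (\<Union>k. {x. g k x = \<infinity>})"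
  have "\<mu> Z \<le> 0"
    using outer_measure_Un[OF om, of E "\<Union>k. {x. g k x = \<infinity>}"] outer_measure_UN_int_null[OF om inf] E
    by (simp add: Z_def)
  then have Z: "\<mu> Z = 0" by simp
  have gfin: "g k x \<noteq> \<infinity>" if "x \<notin> Z" for k x using that by (auto simp: Z_def)
  have diff: "\<bar>u x - u y\<bar> \<noteq> \<infinity>" if "x \<notin> Z" "y \<notin> Z" "x \<noteq> y" for x y
  proof -
    obtain k where k: "2 powi (- k - 1) \<le> dist x y" "dist x y < 2 powi (- k)"
      using dyadic_scale_exists[of "dist x y"] \<open>x \<noteq> y\<close> by auto
    have "ennreal (dist x y powr s) * (g k x + g k y) < \<infinity>"
      using gfin[OF that(1)] gfin[OF that(2)] by (simp add: ennreal_mult_less_top less_top)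
    then have "enn2ereal (ennreal (dist x y powr s) * (g k x + g k y)) < \<infinity>"
      by (simp add: less_ennreal.rep_eq top_ennreal.rep_eq top_ereal_def)
    moreover have "\<bar>u x - u y\<bar> \<le> enn2ereal (ennreal (dist x y powr s) * (g k x + g k y))"
      using that k by (intro grad) (auto simp: Z_def)
    ultimately show ?thesis by auto
  qed
  have fin: "\<bar>u x\<bar> \<noteq> \<infinity>" if "x \<notin> Z" for x
  proof -
    obtain b c :: 'a where bc: "b \<noteq> c" using points by blast
    have hit: "\<exists>y. y \<in> ball z (dist b c / 2) \<and> y \<notin> Z" for z
    proof (rule ccontr)
      assume "\<not> ?thesis"
      then have "\<mu> (ball z (dist b c / 2)) \<le> \<mu> Z" by (intro outer_measure_mono[OF om]) auto
      then show False using balls[of "dist b c / 2" z] bc Z by simp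
    qed
    obtain y z where yz: "y \<in> ball b (dist b c / 2)" "y \<notin> Z" "z \<in> ball c (dist b c / 2)" "z \<notin> Z"
      using hit by blast
    have "y \<noteq> z"
      using yz dist_triangle[of b c y] by (auto simp: dist_commute)
    then obtain w where "w \<notin> Z" "x \<noteq> w" using yz by metis
    then show ?thesis using diff[OF that \<open>w \<notin> Z\<close> \<open>x \<noteq> w\<close>] by (cases "u x"; cases "u w") auto
  qed
  show thesis
  proof
    show "\<mu> Z = 0" by fact
    show "\<bar>u x\<bar> \<noteq> \<infinity>" if "x \<notin> Z" for x using fin that .
    fix k x y
    assume xy: "x \<notin> Z" "y \<notin> Z" and "2 powi (- k - 1) \<le> dist x y" "dist x y < 2 powi (- k)"
    then have *: "\<bar>u x - u y\<bar> \<le> enn2ereal (ennreal (dist x y powr s) * (g k x + g k y))"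
      by (intro grad) (auto simp: Z_def)
    have "\<bar>u x - u y\<bar> = enn2ereal (ennreal \<bar>real_of_ereal (u x) - real_of_ereal (u y)\<bar>)"
      using fin[OF xy(1)] fin[OF xy(2)] by (cases "u x"; cases "u y") auto
    with * show "ennreal \<bar>real_of_ereal (u x) - real_of_ereal (u y)\<bar> \<le> ennreal (dist x y powr s) * (g k x + g k y)"
      by (simp add: less_eq_ennreal.rep_eq)
  qed
qed

text \<open>
  Chebyshev's inequality for \<open>g i\<close> at the threshold \<open>\<kappa> * 2 powr (\<tau> * i) * a i\<close> loses a set of
  measure at most \<open>\<kappa> powr (- p) * 2 powr (- \<tau> * p * i)\<close>, a small part of a ball of radius
  \<open>2 powr (- i)\<close> when \<open>\<tau> = Q / p\<close>.  For finer scales \<open>k\<close> the threshold is raised by the factor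
  \<open>2 powr \<delta>\<close> per scale.  This makes the measures of the exceptional sets summable over \<open>k\<close>,
  and with \<open>\<delta> < s\<close> it is outweighed by the factor \<open>dist x y powr s\<close> in the gradient inequality.  The offset \<open>2\<close>
  leaves room for the distance between the ends of two chains.
\<close>

definition good_set ::
  "'a set \<Rightarrow> (int \<Rightarrow> 'a \<Rightarrow> ennreal) \<Rightarrow> (int \<Rightarrow> real) \<Rightarrow> real \<Rightarrow> real \<Rightarrow> real \<Rightarrow> int \<Rightarrow> 'a set" where
  "good_set Z g a \<kappa> \<tau> \<delta> i = {x. x \<notin> Z \<and>
     (\<forall>k\<ge>i - 2. g k x \<le> ennreal (\<kappa> * 2 powr (\<tau> * real_of_int i + \<delta> * real_of_int (k - i)) * a k))}"

lemma measure_Compl_good_set: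
  assumes om: "outer_measure_space UNIV \<mu>" and "\<mu> Z = 0"
    and meas: "\<And>k. g k \<in> borel_measurable (cara_measure \<mu>)"
    and norm: "\<And>k. Lp_norm (cara_measure \<mu>) p (g k) = ennreal (a k)" "\<And>k. 0 \<le> a k"
    and "0 < p" "0 < \<delta>" "0 < \<kappa>"
  shows "\<mu> (- good_set Z g a \<kappa> \<tau> \<delta> i)
    \<le> ennreal (\<kappa> powr (- p) * (2 powr (2 * \<delta> * p) / (1 - 2 powr (- \<delta> * p))) * 2 powr (- (\<tau> * p) * real_of_int i))"
proof -
  let ?b = "\<lambda>n. \<kappa> * 2 powr (\<tau> * real_of_int i + \<delta> * (real n - 2))"
  let ?T = "\<kappa> powr (- p) * 2 powr (2 * \<delta> * p) * 2 powr (- (\<tau> * p) * real_of_int i)"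
  let ?x = "2 powr (- \<delta> * p)"
  let ?H = "\<lambda>n. {x. ennreal (?b n * a (i - 2 + int n)) < g (i - 2 + int n) x}"
  have x: "0 < ?x" "?x < 1" using \<open>0 < \<delta>\<close> \<open>0 < p\<close> by (auto simp: powr_less_one mult_neg_pos)
  have H: "\<mu> (?H n) \<le> ennreal (?T * ?x ^ n)" for n
  proof -
    have "\<mu> (?H n) \<le> ennreal (?b n powr (- p))"
      using \<open>0 < p\<close> \<open>0 < \<kappa>\<close> by (intro cara_weak_type[OF om meas norm]) auto
    also have "?b n powr (- p) = ?T * 2 powr (- \<delta> * p * real n)"
      using \<open>0 < \<kappa>\<close> by (simp add: powr_mult powr_powr powr_add[symmetric] algebra_simps)
    also have "2 powr (- \<delta> * p * real n) = ?x ^ n"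
      by (simp add: powr_realpow[symmetric] powr_powr)
    finally show ?thesis .
  qed
  have "- good_set Z g a \<kappa> \<tau> \<delta> i \<subseteq> Z \<union> (\<Union>n. ?H n)"
  proof
    fix x assume "x \<in> - good_set Z g a \<kappa> \<tau> \<delta> i"
    then have "x \<in> Z \<or> (\<exists>k\<ge>i - 2. ennreal (\<kappa> * 2 powr (\<tau> * real_of_int i + \<delta> * real_of_int (k - i)) * a k) < g k x)"
      unfolding good_set_def by (auto simp: not_le)
    then show "x \<in> Z \<union> (\<Union>n. ?H n)"
    proof (elim disjE exE conjE)
      fix k assume k: "k \<ge> i - 2" "ennreal (\<kappa> * 2 powr (\<tau> * real_of_int i + \<delta> * real_of_int (k - i)) * a k) < g k x"
      then obtain n where n: "k = i - 2 + int n" using zle_iff_zadd by blast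
      have "real_of_int (k - i) = real n - 2" unfolding n by simp
      then have "x \<in> ?H n" using k(2) n by simp
      then show ?thesis by blast
    qed simp
  qed
  then have "\<mu> (- good_set Z g a \<kappa> \<tau> \<delta> i) \<le> \<mu> (Z \<union> (\<Union>n. ?H n))"
    by (rule outer_measure_mono[OF om])
  also have "\<dots> \<le> \<mu> Z + \<mu> (\<Union>n. ?H n)" by (rule outer_measure_Un[OF om])
  also have "\<dots> \<le> (\<Sum>n. \<mu> (?H n))" using outer_measure_UN[OF om, of ?H] \<open>\<mu> Z = 0\<close> by simp
  also have "\<dots> \<le> (\<Sum>n. ennreal (?T * ?x ^ n))" by (intro suminf_le H summableI)
  also have "\<dots> = ennreal (?T * (1 / (1 - ?x)))"
    using x by (intro suminf_ennreal_eq sums_mult geometric_sums) auto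
  also have "?T * (1 / (1 - ?x)) = \<kappa> powr (- p) * (2 powr (2 * \<delta> * p) / (1 - ?x)) * 2 powr (- (\<tau> * p) * real_of_int i)"
    by simp
  finally show ?thesis .
qed

text \<open>
  At a scale \<open>k \<ge> i - 2\<close> the gradient inequality contributes
  \<open>2 powr (- s * k)\<close> times the bound in the good set, that is
  \<open>\<kappa> * 2 powr (\<sigma> * i) * 2 powr (- \<epsilon> * (k - i)) * a k\<close>.  For \<open>k \<ge> i\<close> this is a term of the
  supremum that defines the envelope at \<open>i\<close>; the two remaining scales cost the factor
  \<open>2 powr (4 * \<epsilon>)\<close>.
\<close>

lemma gradient_on_good_sets:
  fixes a :: "int \<Rightarrow> real" and x y :: "'a::metric_space" and v :: "'a \<Rightarrow> real"
  assumes "bounded_sequence \<epsilon> a N"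
    and grad: "\<And>k x y. x \<notin> Z \<Longrightarrow> y \<notin> Z \<Longrightarrow> 2 powi (- k - 1) \<le> dist x y \<Longrightarrow> dist x y < 2 powi (- k) \<Longrightarrow>
      ennreal \<bar>v x - v y\<bar> \<le> ennreal (dist x y powr s) * (g k x + g k y)"
    and "0 < s" "0 < \<kappa>" "\<sigma> = \<tau> - s"
    and x: "x \<in> good_set Z g a \<kappa> \<tau> (s - \<epsilon>) i" and y: "y \<in> good_set Z g a \<kappa> \<tau> (s - \<epsilon>) j"
    and "dist x y < 2 powi (2 - i)" "dist x y < 2 powi (2 - j)"
  shows "\<bar>v x - v y\<bar> \<le> \<kappa> * 2 powr (4 * \<epsilon>) *
    (2 powr (\<sigma> * real_of_int i) * dyadic_envelope \<epsilon> a i + 2 powr (\<sigma> * real_of_int j) * dyadic_envelope \<epsilon> a j)"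
proof -
  interpret bounded_sequence \<epsilon> a N by fact
  show ?thesis
  proof (cases "x = y")
    case True
    then show ?thesis using \<open>0 < \<kappa>\<close> envelope_nonneg by simp
  next
    case False
    then obtain k where k: "2 powi (- k - 1) \<le> dist x y" "dist x y < 2 powi (- k)"
      using dyadic_scale_exists[of "dist x y"] by auto
    have scale: "i' - 2 \<le> k" if "dist x y < 2 powi (2 - i')" for i'
    proof -
      have "(2::real) powr real_of_int (- k - 1) < 2 powr real_of_int (2 - i')"
        using that k(1) unfolding powi_eq_powr by linarith
      then have "- k - 1 < 2 - i'" by simp
      then show ?thesis by simp
    qed
    have half: "ennreal (dist x y powr s) * g k z
        \<le> ennreal (\<kappa> * 2 powr (4 * \<epsilon>) * (2 powr (\<sigma> * real_of_int i') * env i'))"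
      if z: "z \<in> good_set Z g a \<kappa> \<tau> (s - \<epsilon>) i'" and "i' - 2 \<le> k" for z i'
    proof -
      have "dist x y powr s \<le> (2 powr real_of_int (- k)) powr s"
        using k \<open>0 < s\<close> unfolding powi_eq_powr by (intro powr_mono2) auto
      then have d: "dist x y powr s \<le> 2 powr (- s * real_of_int k)"
        by (simp add: powr_powr mult.commute)
      have "ennreal (dist x y powr s) * g k z \<le> ennreal (2 powr (- s * real_of_int k)) *
          ennreal (\<kappa> * 2 powr (\<tau> * real_of_int i' + (s - \<epsilon>) * real_of_int (k - i')) * a k)"
        using z \<open>i' - 2 \<le> k\<close> d by (intro mult_mono ennreal_leI) (auto simp: good_set_def)
      also have "\<dots> = ennreal (\<kappa> * (2 powr (- s * real_of_int k) *
          2 powr (\<tau> * real_of_int i' + (s - \<epsilon>) * real_of_int (k - i')) * a k))"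
        using \<open>0 < \<kappa>\<close> a_nonneg by (simp add: ennreal_mult[symmetric] ac_simps)
      also have "2 powr (- s * real_of_int k) * 2 powr (\<tau> * real_of_int i' + (s - \<epsilon>) * real_of_int (k - i'))
          = 2 powr (\<sigma> * real_of_int i' + (- \<epsilon>) * real_of_int (k - i'))"
        unfolding powr_add[symmetric] \<open>\<sigma> = \<tau> - s\<close> by (simp add: algebra_simps)
      also have "ennreal (\<kappa> * (2 powr (\<sigma> * real_of_int i' + (- \<epsilon>) * real_of_int (k - i')) * a k))
          \<le> ennreal (\<kappa> * (2 powr (\<sigma> * real_of_int i' + 4 * \<epsilon> + - \<epsilon> * \<bar>real_of_int (k - i')\<bar>) * a k))"
      proof (intro ennreal_leI mult_left_mono mult_right_mono powr_mono a_nonneg)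
        have "\<epsilon> * \<bar>real_of_int (k - i')\<bar> \<le> \<epsilon> * (4 + real_of_int (k - i'))"
          using \<epsilon>_pos \<open>i' - 2 \<le> k\<close> by (intro mult_left_mono) auto
        then show "\<sigma> * real_of_int i' + (- \<epsilon>) * real_of_int (k - i')
            \<le> \<sigma> * real_of_int i' + 4 * \<epsilon> + - \<epsilon> * \<bar>real_of_int (k - i')\<bar>"
          by (simp add: algebra_simps)
      qed (use \<open>0 < \<kappa>\<close> in auto)
      also have "\<kappa> * (2 powr (\<sigma> * real_of_int i' + 4 * \<epsilon> + - \<epsilon> * \<bar>real_of_int (k - i')\<bar>) * a k)
          = \<kappa> * 2 powr (4 * \<epsilon>) * (2 powr (\<sigma> * real_of_int i') * (2 powr (- \<epsilon> * \<bar>real_of_int (k - i')\<bar>) * a k))"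
        by (simp only: powr_add) (simp only: ac_simps)
      also have "ennreal \<dots> \<le> ennreal (\<kappa> * 2 powr (4 * \<epsilon>) * (2 powr (\<sigma> * real_of_int i') * env i'))"
        using \<open>0 < \<kappa>\<close> by (intro ennreal_leI mult_left_mono le_envelope) auto
      finally show ?thesis .
    qed
    have "ennreal \<bar>v x - v y\<bar> \<le> ennreal (dist x y powr s) * (g k x + g k y)"
      using x y by (intro grad k) (auto simp: good_set_def)
    also have "\<dots> \<le> ennreal (\<kappa> * 2 powr (4 * \<epsilon>) * (2 powr (\<sigma> * real_of_int i) * env i))
        + ennreal (\<kappa> * 2 powr (4 * \<epsilon>) * (2 powr (\<sigma> * real_of_int j) * env j))"
      unfolding distrib_left by (intro add_mono half x y scale assms)
    also have "\<dots> = ennreal (\<kappa> * 2 powr (4 * \<epsilon>) *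
        (2 powr (\<sigma> * real_of_int i) * env i + 2 powr (\<sigma> * real_of_int j) * env j))"
      using \<open>0 < \<kappa>\<close> envelope_nonneg by (simp add: ennreal_plus[symmetric] distrib_left del: ennreal_plus)
    finally show ?thesis
      using \<open>0 < \<kappa>\<close> envelope_nonneg by (simp add: ennreal_le_iff)
  qed
qed

text \<open>
  In a bounded space this bounds the distribution function at the levels that belong to
  radii beyond the diameter, to which regularity does not apply.  An open ball whose radius is the
  diameter can miss points of the space, and doubling passes to the ball of twice that radius.
\<close>

lemma measure_space_le_of_small_diameter:
  fixes \<mu> :: "'a::metric_space set \<Rightarrow> ennreal"
  assumes om: "outer_measure_space UNIV \<mu>" and "doubling \<mu>" and "Q_regular Q \<mu>" and "0 < Q"
    and points: "\<exists>x y :: 'a. x \<noteq> y"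
  shows "\<exists>B>0. \<forall>r. ediam TYPE('a) < ennreal r \<longrightarrow> \<mu> UNIV \<le> ennreal (B * r powr Q)"
proof -
  obtain cD where cD: "0 < cD" "\<And>x r. 0 < r \<Longrightarrow> \<mu> (ball x (2 * r)) \<le> ennreal cD * \<mu> (ball x r)"
    using \<open>doubling \<mu>\<close> by (auto simp: doubling_def)
  obtain cQ where cQ: "1 \<le> cQ" "\<And>(x::'a) r. 0 < r \<Longrightarrow> ennreal r \<le> ediam TYPE('a) \<Longrightarrow> \<mu> (ball x r) \<le> ennreal (cQ * r powr Q)"
    using \<open>Q_regular Q \<mu>\<close> by (auto simp: Q_regular_def)
  have "\<mu> UNIV \<le> ennreal (cD * cQ * r powr Q)" if r: "ediam TYPE('a) < ennreal r" for r
  proof -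
    obtain d where d: "ediam TYPE('a) = ennreal d" "0 \<le> d"
      using r by (cases "ediam TYPE('a)") auto
    have dist: "dist x y \<le> d" for x y :: 'a
    proof -
      have "ennreal (dist x y) \<le> ediam TYPE('a)"
        unfolding ediam_def by (intro SUP_upper2[of x] SUP_upper2[of y]) auto
      then show ?thesis using d by simp
    qed
    obtain x y :: 'a where "x \<noteq> y" using points by blast
    then have "0 < d" using dist[of x y] by (meson dual_order.strict_trans1 zero_less_dist_iff)
    have "d < r" using r d by (simp add: ennreal_less_iff)
    have "\<mu> UNIV = \<mu> (ball x (2 * d))"
      using dist[of x] \<open>0 < d\<close> by (intro arg_cong[of _ _ \<mu>]) (force intro: le_less_trans)
    also have "\<dots> \<le> ennreal cD * \<mu> (ball x d)" using cD \<open>0 < d\<close> by blast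
    also have "\<dots> \<le> ennreal cD * ennreal (cQ * d powr Q)"
      using cQ(2)[of d x] \<open>0 < d\<close> d by (intro mult_left_mono) auto
    also have "\<dots> = ennreal (cD * cQ * d powr Q)"
      using cD cQ by (simp add: ennreal_mult[symmetric] ac_simps)
    also have "\<dots> \<le> ennreal (cD * cQ * r powr Q)"
      using cD cQ \<open>0 < d\<close> \<open>d < r\<close> \<open>0 < Q\<close> by (intro ennreal_leI mult_left_mono powr_mono2) auto
    finally show ?thesis .
  qed
  then show ?thesis using cD cQ by (intro exI[of _ "cD * cQ"]) auto
qed

section \<open>The Sobolev--Lorentz inequality\<close>

text \<open>
  The constant \<open>\<kappa>\<close> is chosen so large that the complement of each good set is smaller than a ball
  of half its scale.  So that ball meets the good set of the next coarser scale, which gives the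
  steps of the chains.  The constant \<open>D\<close> is the sum of the geometric series along a chain.
\<close>

lemma oscillation_levels:
  fixes \<mu> :: "'a::metric_space set \<Rightarrow> ennreal"
  assumes dm: "doubling_metric_measure \<mu>" and reg: "Q_regular Q \<mu>" and "0 < Q"
    and points: "\<exists>x y :: 'a. x \<noteq> y"
    and "0 < s" "0 < p" "\<sigma> = Q / p - s" "0 < \<epsilon>" "\<epsilon> < \<sigma>" "\<epsilon> < s"
  shows "\<exists>D>0. \<exists>B>0. \<forall>u g a N. g \<in> frac_gradients \<mu> s u \<longrightarrow> bounded_sequence \<epsilon> a N \<longrightarrow>
    (\<forall>k. Lp_norm (cara_measure \<mu>) p (g k) = ennreal (a k)) \<longrightarrow>
    (\<exists>c::real. \<forall>j. \<mu> {x. ereal (dyadic_levels.level \<epsilon> a \<sigma> D j) < \<bar>u x - ereal c\<bar>}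
       \<le> ennreal (B * 2 powr (- Q * real_of_int j)))"
proof -
  have om: "outer_measure_space UNIV \<mu>" and "doubling \<mu>"
    and balls: "\<And>x r. 0 < r \<Longrightarrow> 0 < \<mu> (ball x r)"
    using dm by (auto simp: doubling_metric_measure_def borel_regular_outer_measure_def)
  obtain B0 where B0: "0 < B0" "\<And>r. ediam TYPE('a) < ennreal r \<Longrightarrow> \<mu> UNIV \<le> ennreal (B0 * r powr Q)"
    using measure_space_le_of_small_diameter[OF om \<open>doubling \<mu>\<close> reg \<open>0 < Q\<close> points] by blast
  obtain cQ where cQ: "1 \<le> cQ" "\<And>(x::'a) r. 0 < r \<Longrightarrow> ennreal r \<le> ediam TYPE('a) \<Longrightarrow> ennreal (inverse cQ * r powr Q) \<le> \<mu> (ball x r)"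
    using reg by (auto simp: Q_regular_def)
  define \<delta> where "\<delta> = s - \<epsilon>"
  have "0 < \<delta>" using \<open>\<epsilon> < s\<close> by (simp add: \<delta>_def)
  define S where "S = 2 powr (2 * \<delta> * p) / (1 - 2 powr (- \<delta> * p))"
  have "2 powr (- \<delta> * p) < 1" using \<open>0 < \<delta>\<close> \<open>0 < p\<close> by (auto simp: powr_less_one mult_neg_pos)
  then have "0 < S" by (simp add: S_def)
  (* Half the lower bound for the measure of a ball of radius 1 / 2. *)
  define \<theta> where "\<theta> = inverse cQ * 2 powr (- Q) / 2"
  have "0 < \<theta>" using cQ(1) by (simp add: \<theta>_def)
  define \<kappa> where "\<kappa> = (S / \<theta>) powr (1 / p)"
  have "0 < \<kappa>" using \<open>0 < S\<close> \<open>0 < \<theta>\<close> by (simp add: \<kappa>_def)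
  have \<kappa>S: "\<kappa> powr (- p) * S = \<theta>"
    using \<open>0 < S\<close> \<open>0 < \<theta>\<close> \<open>0 < p\<close> by (simp add: \<kappa>_def powr_powr powr_minus)
  define A where "A = 2 * (\<kappa> * 2 powr (4 * \<epsilon>))"
  have "0 < A" using \<open>0 < \<kappa>\<close> by (simp add: A_def)
  define \<rho> where "\<rho> = 2 powr (\<sigma> - \<epsilon>)"
  have "1 < \<rho>" using powr_less_mono[of 0 "\<sigma> - \<epsilon>" 2] \<open>\<epsilon> < \<sigma>\<close> by (simp add: \<rho>_def)
  (* The factor is the sum of the series of the powers of 1 / \<rho>, as levels grow by \<rho> per step. *)
  define D where "D = A * (\<rho> / (\<rho> - 1))"
  have "1 \<le> \<rho> / (\<rho> - 1)" using \<open>1 < \<rho>\<close> by (simp add: field_simps)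
  then have "A * 1 \<le> D" unfolding D_def using \<open>0 < A\<close> by (intro mult_left_mono) auto
  then have "A \<le> D" by simp
  then have "0 < D" using \<open>0 < A\<close> by simp
  define J where "J = {j::int. ennreal (2 powi (- j)) \<le> ediam TYPE('a)}"
  have J_up: "j \<in> J" if "i \<in> J" "i \<le> j" for i j
  proof -
    have "(2::real) powi (- j) \<le> 2 powi (- i)" using \<open>i \<le> j\<close> by (intro power_int_increasing) auto
    then show ?thesis using \<open>i \<in> J\<close> unfolding J_def by (auto intro: order_trans[OF ennreal_leI])
  qed
  have J_scale: "k \<in> J" if "2 powi (- k) \<le> dist x y" for k and x y :: 'a
  proof -
    have "ennreal (dist x y) \<le> ediam TYPE('a)"
      unfolding ediam_def by (intro SUP_upper2[of x] SUP_upper2[of y]) auto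
    then show ?thesis using that unfolding J_def by (auto intro: order_trans[OF ennreal_leI])
  qed
  have main: "\<exists>c::real. \<forall>j. \<mu> {x. ereal (dyadic_levels.level \<epsilon> a \<sigma> D j) < \<bar>u x - ereal c\<bar>}
       \<le> ennreal ((\<theta> + B0) * 2 powr (- Q * real_of_int j))"
    if g: "g \<in> frac_gradients \<mu> s u" and "bounded_sequence \<epsilon> a N"
      and norm: "\<And>k. Lp_norm (cara_measure \<mu>) p (g k) = ennreal (a k)" for u g a N
  proof -
    interpret bounded_sequence \<epsilon> a N by fact
    interpret one: dyadic_levels \<epsilon> a N \<sigma> 1 using \<open>\<epsilon> < \<sigma>\<close> by unfold_locales auto
    interpret dyadic_levels \<epsilon> a N \<sigma> D using \<open>\<epsilon> < \<sigma>\<close> \<open>0 < D\<close> by unfold_locales auto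
    have level: "level j = D * one.level j" for j by (simp add: level_def one.level_def)
    have meas: "\<And>k. g k \<in> borel_measurable (cara_measure \<mu>)"
      using g by (simp add: frac_gradients_def)
    obtain Z where Z: "\<mu> Z = 0" "\<And>x. x \<notin> Z \<Longrightarrow> \<bar>u x\<bar> \<noteq> \<infinity>"
      and grad: "\<And>k x y. x \<notin> Z \<Longrightarrow> y \<notin> Z \<Longrightarrow> 2 powi (- k - 1) \<le> dist x y \<Longrightarrow> dist x y < 2 powi (- k) \<Longrightarrow>
        ennreal \<bar>real_of_ereal (u x) - real_of_ereal (u y)\<bar> \<le> ennreal (dist x y powr s) * (g k x + g k y)"
      using finite_off_null_set[OF om balls points g norm a_nonneg \<open>0 < p\<close>] by metis
    define v where "v x = real_of_ereal (u x)" for x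
    define G where "G = good_set Z g a \<kappa> (Q / p) \<delta>"
    have G: "\<mu> (- G i) \<le> ennreal (\<theta> * 2 powr (- Q * real_of_int i))" for i
      using measure_Compl_good_set[where g = g and a = a and \<tau> = "Q / p" and i = i, OF om Z(1) meas norm a_nonneg
          \<open>0 < p\<close> \<open>0 < \<delta>\<close> \<open>0 < \<kappa>\<close>, folded S_def, unfolded \<kappa>S]
        \<open>0 < p\<close> by (simp add: G_def)
    have osc: "\<bar>v x - v y\<bar> \<le> A / 2 * (one.level i + one.level j)"
      if "x \<in> G i" "y \<in> G j" "dist x y < 2 powi (2 - i)" "dist x y < 2 powi (2 - j)" for x y i j
      using gradient_on_good_sets[where x = x and y = y and i = i and j = j,
          OF \<open>bounded_sequence \<epsilon> a N\<close> grad \<open>0 < s\<close> \<open>0 < \<kappa>\<close> \<open>\<sigma> = Q / p - s\<close>] that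
      by (simp add: v_def G_def \<delta>_def A_def one.level_def)
    have "\<exists>c. \<forall>j\<in>J. \<forall>x\<in>G j. \<bar>v x - c\<bar> \<le> D * one.level j"
    proof (rule common_constant[where A = A])
      show "0 \<le> one.level i" for i by (rule one.level_nonneg)
      show "0 \<le> A" "A \<le> D" using \<open>0 < A\<close> \<open>A \<le> D\<close> by auto
      show "j \<in> J" if "i \<in> J" "i \<le> j" for i j using J_up that .
      show "k \<in> J" if "2 powi (- k) \<le> dist x y" for k and x y :: 'a using J_scale that .
      show "A * one.level (i + 1) \<le> D * (one.level (i + 1) - one.level i)" for i
      proof -
        have "\<rho> * one.level i \<le> one.level (i + 1)"
          using one.level_grow[of i "i + 1"] by (simp add: \<rho>_def)
        then have "\<rho> * one.level (i + 1) - one.level (i + 1) \<le> \<rho> * (one.level (i + 1) - one.level i)"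
          by (simp add: right_diff_distrib)
        then have "one.level (i + 1) \<le> \<rho> / (\<rho> - 1) * (one.level (i + 1) - one.level i)"
          using \<open>1 < \<rho>\<close> by (simp add: field_simps)
        then have "A * one.level (i + 1) \<le> A * (\<rho> / (\<rho> - 1) * (one.level (i + 1) - one.level i))"
          using \<open>0 < A\<close> by (intro mult_left_mono) auto
        then show ?thesis by (simp only: D_def mult.assoc)
      qed
      show "\<bar>v x - v y\<bar> \<le> A * one.level i"
        if "i \<in> J" "x \<in> G i" "y \<in> G i" "dist x y < 2 powi (2 - i)" for i x y
        using osc[OF that(2,3,4,4)] by simp
      show "\<exists>y\<in>G i. dist x y \<le> 2 powi (- (i + 1)) \<and> \<bar>v x - v y\<bar> \<le> A * one.level (i + 1)"
        if "i \<in> J" "x \<in> G (i + 1)" for i x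
      proof -
        let ?r = "2 powi (- (i + 1)) :: real"
        have r: "?r powr Q = 2 powr (- Q) * 2 powr (- Q * real_of_int i)"
          unfolding powi_eq_powr by (simp add: powr_powr powr_add[symmetric] algebra_simps)
        have "\<not> ball x ?r \<subseteq> - G i"
        proof
          assume "ball x ?r \<subseteq> - G i"
          then have "\<mu> (ball x ?r) \<le> \<mu> (- G i)" by (rule outer_measure_mono[OF om])
          also note G
          finally have "\<mu> (ball x ?r) \<le> ennreal (\<theta> * 2 powr (- Q * real_of_int i))" .
          moreover have "i + 1 \<in> J" using J_up[OF \<open>i \<in> J\<close>, of "i + 1"] by simp
          then have "ennreal (inverse cQ * ?r powr Q) \<le> \<mu> (ball x ?r)"
            unfolding J_def by (intro cQ(2)) auto
          ultimately have "ennreal (inverse cQ * ?r powr Q) \<le> ennreal (\<theta> * 2 powr (- Q * real_of_int i))"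
            by (rule order_trans[rotated])
          then have "inverse cQ * ?r powr Q \<le> \<theta> * 2 powr (- Q * real_of_int i)"
            using \<open>0 < \<theta>\<close> by (simp add: ennreal_le_iff)
          also have "inverse cQ * ?r powr Q = 2 * \<theta> * 2 powr (- Q * real_of_int i)"
            unfolding r by (simp add: \<theta>_def)
          finally show False using \<open>0 < \<theta>\<close> by simp
        qed
        then obtain y where y: "y \<in> G i" "dist x y < ?r" by auto
        have "?r \<le> 2 powi (2 - (i + 1))" "?r \<le> 2 powi (2 - i)"
          by (auto intro!: power_int_increasing)
        then have "\<bar>v x - v y\<bar> \<le> A / 2 * (one.level (i + 1) + one.level i)"
          using y by (intro osc \<open>x \<in> G (i + 1)\<close>) auto
        also have "\<dots> \<le> A / 2 * (one.level (i + 1) + one.level (i + 1))"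
          using \<open>0 < A\<close> by (intro mult_left_mono add_left_mono one.level_mono) auto
        finally show ?thesis using y by (intro bexI[of _ y]) auto
      qed
    qed
    then obtain c where c: "\<And>j x. j \<in> J \<Longrightarrow> x \<in> G j \<Longrightarrow> \<bar>v x - c\<bar> \<le> level j"
      unfolding level by blast
    have "\<mu> {x. ereal (level j) < \<bar>u x - ereal c\<bar>} \<le> ennreal ((\<theta> + B0) * 2 powr (- Q * real_of_int j))" for j
    proof (cases "j \<in> J")
      case True
      have "\<bar>u x - ereal c\<bar> \<le> ereal (level j)" if "x \<in> G j" for x
      proof -
        have "\<bar>u x\<bar> \<noteq> \<infinity>" using Z(2) that by (auto simp: G_def good_set_def)
        then have "\<bar>u x - ereal c\<bar> = ereal \<bar>v x - c\<bar>" by (cases "u x") (auto simp: v_def)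
        then show ?thesis using c[OF True that] by simp
      qed
      then have "\<mu> {x. ereal (level j) < \<bar>u x - ereal c\<bar>} \<le> \<mu> (- G j)"
        by (intro outer_measure_mono[OF om]) (auto simp: not_le[symmetric])
      also note G
      also have "ennreal (\<theta> * 2 powr (- Q * real_of_int j)) \<le> ennreal ((\<theta> + B0) * 2 powr (- Q * real_of_int j))"
        using B0(1) by (intro ennreal_leI mult_right_mono) auto
      finally show ?thesis .
    next
      case False
      then have "\<mu> UNIV \<le> ennreal (B0 * (2 powi (- j)) powr Q)"
        by (intro B0(2)) (simp add: J_def not_le)
      also have "(2 powi (- j)) powr Q = 2 powr (- Q * real_of_int j)"
        unfolding powi_eq_powr by (simp add: powr_powr mult.commute)
      also have "ennreal (B0 * 2 powr (- Q * real_of_int j)) \<le> ennreal ((\<theta> + B0) * 2 powr (- Q * real_of_int j))"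
        using \<open>0 < \<theta>\<close> by (intro ennreal_leI mult_right_mono) auto
      finally show ?thesis
        using outer_measure_mono[OF om subset_UNIV] by (rule order_trans[rotated])
    qed
    then show ?thesis by blast
  qed
  have "0 < \<theta> + B0" using \<open>0 < \<theta>\<close> B0(1) by simp
  with \<open>0 < D\<close> main show ?thesis by blast
qed

text \<open>
  Every gradient with finite sequence norm has finite norms \<open>a k\<close>, bounded by it, and yields the
  inequality with its own constant \<open>c\<close> for \<open>u\<close> but with a common \<open>C\<close>, so that the infimum over
  gradients can be taken on the right-hand side.
\<close>

theorem theorem4p4:
  fixes \<mu> :: "'a::metric_space set \<Rightarrow> ennreal"
    and Q s p :: real and q :: ennreal
  assumes "doubling_metric_measure \<mu>"
    and "Q_regular Q \<mu>" and "Q \<ge> 1"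
    and "\<exists>x y :: 'a. x \<noteq> y"
    and "0 < s" and "s < 1"
    and "0 < p" and "p < Q / s"
    and "0 < q"
  shows "\<exists>C>0. \<forall>u \<in> hajlasz_besov_space \<mu> s p q.
           (INF c::real. lorentz_norm \<mu> (Q * p / (Q - s * p)) q (\<lambda>x. u x - ereal c))
             \<le> ennreal C * hajlasz_besov_norm \<mu> s p q u"
proof -
  define P where "P = Q * p / (Q - s * p)"
  define \<sigma> where "\<sigma> = Q / p - s"
  define \<epsilon> where "\<epsilon> = min s \<sigma> / 2"
  have "0 < Q" using \<open>Q \<ge> 1\<close> by simp
  have sp: "s * p < Q" using assms(5,8) by (simp add: field_simps)
  then have "0 < P" and \<sigma>: "\<sigma> = Q / P" and "0 < \<sigma>"
    using \<open>0 < Q\<close> \<open>0 < p\<close> by (auto simp: P_def \<sigma>_def field_simps)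
  have \<epsilon>: "0 < \<epsilon>" "\<epsilon> < \<sigma>" "\<epsilon> < s" using \<open>0 < \<sigma>\<close> \<open>0 < s\<close> by (auto simp: \<epsilon>_def)
  obtain D B where "0 < D" "0 < B" and osc: "\<And>u g a N. g \<in> frac_gradients \<mu> s u \<Longrightarrow>
      bounded_sequence \<epsilon> a N \<Longrightarrow> (\<And>k. Lp_norm (cara_measure \<mu>) p (g k) = ennreal (a k)) \<Longrightarrow>
      \<exists>c::real. \<forall>j. \<mu> {x. ereal (dyadic_levels.level \<epsilon> a \<sigma> D j) < \<bar>u x - ereal c\<bar>}
         \<le> ennreal (B * 2 powr (- Q * real_of_int j))"
    using oscillation_levels[OF assms(1,2) \<open>0 < Q\<close> assms(4,5,7) \<sigma>_def \<epsilon>] by blast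
  obtain C where "0 < C" and lor: "\<And>a N w. dyadic_levels \<epsilon> a N \<sigma> D \<Longrightarrow> outer_measure_space UNIV \<mu> \<Longrightarrow>
      (\<And>j. \<mu> {x. ereal (dyadic_levels.level \<epsilon> a \<sigma> D j) < \<bar>w x\<bar>} \<le> ennreal (B * 2 powr (- Q * real_of_int j))) \<Longrightarrow>
      lorentz_norm \<mu> P q w \<le> ennreal C * lq_norm q (\<lambda>k. ennreal (a k))"
    using lorentz_norm_le_of_levels[OF \<open>0 < Q\<close> \<open>0 < P\<close> \<sigma> \<epsilon>(1,2) \<open>0 < D\<close> \<open>0 < B\<close> \<open>0 < q\<close>] by blast
  have om: "outer_measure_space UNIV \<mu>"
    using assms(1) by (simp add: doubling_metric_measure_def borel_regular_outer_measure_def)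
  have gradient: "(INF c::real. lorentz_norm \<mu> P q (\<lambda>x. u x - ereal c))
      \<le> ennreal C * lq_norm q (\<lambda>k. Lp_norm (cara_measure \<mu>) p (g k))"
    if g: "g \<in> frac_gradients \<mu> s u" for u g
  proof (cases "lq_norm q (\<lambda>k. Lp_norm (cara_measure \<mu>) p (g k))")
    case (real N)
    let ?L = "\<lambda>k. Lp_norm (cara_measure \<mu>) p (g k)"
    define a where "a k = enn2real (?L k)" for k
    have le: "?L k \<le> ennreal N" for k using le_lq_norm[OF \<open>0 < q\<close>, of ?L k] real by simp
    then have a: "?L k = ennreal (a k)" for k
      unfolding a_def using le_less_trans[OF le ennreal_less_top] by (simp add: ennreal_enn2real)
    have seq: "bounded_sequence \<epsilon> a N"
    proof
      show "a i \<le> N" for i using le[of i] real(1) unfolding a by simp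
    qed (use \<epsilon> in \<open>auto simp: a_def\<close>)
    then have lev: "dyadic_levels \<epsilon> a N \<sigma> D"
      using \<epsilon> \<open>0 < D\<close> by (simp add: dyadic_levels_def dyadic_levels_axioms_def)
    obtain c :: real where "\<And>j. \<mu> {x. ereal (dyadic_levels.level \<epsilon> a \<sigma> D j) < \<bar>u x - ereal c\<bar>}
         \<le> ennreal (B * 2 powr (- Q * real_of_int j))"
      using osc[OF g seq a] by blast
    then have "lorentz_norm \<mu> P q (\<lambda>x. u x - ereal c) \<le> ennreal C * lq_norm q (\<lambda>k. ennreal (a k))"
      by (rule lor[OF lev om])
    then show ?thesis unfolding a by (rule INF_lower2[OF UNIV_I])
  next
    case top
    then show ?thesis using \<open>0 < C\<close> by (simp add: ennreal_mult_top)
  qed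
  have "(INF c::real. lorentz_norm \<mu> P q (\<lambda>x. u x - ereal c)) \<le> ennreal C * hajlasz_besov_norm \<mu> s p q u" for u
  proof -
    have "(INF c::real. lorentz_norm \<mu> P q (\<lambda>x. u x - ereal c)) / ennreal C \<le> hajlasz_besov_norm \<mu> s p q u"
      unfolding hajlasz_besov_norm_def
    proof (rule INF_greatest)
      fix g assume "g \<in> frac_gradients \<mu> s u"
      then show "(INF c::real. lorentz_norm \<mu> P q (\<lambda>x. u x - ereal c)) / ennreal C
          \<le> lq_norm q (\<lambda>k. Lp_norm (cara_measure \<mu>) p (g k))"
        using gradient \<open>0 < C\<close> by (intro divide_le_posI_ennreal) (auto simp: mult.commute)
    qed
    then have "ennreal C * ((INF c::real. lorentz_norm \<mu> P q (\<lambda>x. u x - ereal c)) / ennreal C)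
        \<le> ennreal C * hajlasz_besov_norm \<mu> s p q u"
      by (rule mult_left_mono) simp
    moreover have "ennreal C * (x / ennreal C) = x" for x
      using \<open>0 < C\<close> by (simp add: ennreal_times_divide ennreal_mult_divide_eq mult.commute)
    ultimately show ?thesis by simp
  qed
  then show ?thesis using \<open>0 < C\<close> unfolding P_def by blast
qed

end
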